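(* Let $r\ge 1$ be an integer, let $x\in\mathbb{R}^+$, and let $f$ belong to $C^{(r)}(\mathbb{R}^+)$ locally at $x$, that is, $f:\mathbb{R}^+\to\mathbb{R}$ is a bounded measurable function that is $r$ times continuously differentiable in a neighbourhood of $x$. Then for $w>0$ $$(I_w^{\chi,\phi}f)(x)-f(x)=\sum_{j=1}^r\frac{\theta^jf(x)}{j!\,w^j}\left(\sum_{\eta=0}^j\binom{j}{\eta}\hat m_{j-\eta}(\phi)\,m_\eta(\chi,x)\right)+R_{w,r}(x),$$ where $$R_{w,r}(x)=\sum_{k\in\mathbb{Z}}\chi(e^{-k}x^w)\,w\int_0^\infty\phi(e^{-k}t^w)\,h\!\left(\frac tx\right)(\log t-\log x)^r\frac{dt}{t}.$$ Moreover, $R_{w,r}(x)=o(w^{-r})$ as $w\to+\infty$, for every such $x\in\mathbb{R}^+$.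
   Context: $\mathbb{R}^+=(0,\infty)$ carries the measure $d\mu=dt/t$. The kernels are a continuous function $\chi:\mathbb{R}^+\to\mathbb{R}$ and a function $\phi:\mathbb{R}^+\to\mathbb{R}$ with $\phi\in L^1(\mu)$. For $\nu\in\mathbb{N}_0$ put $$m_\nu(\chi,u)=\sum_{k\in\mathbb{Z}}\chi(e^{-k}u)(k-\log u)^\nu,\quad M_\nu(\chi)=\sup_{u\in\mathbb{R}^+}\sum_{k\in\mathbb{Z}}|\chi(e^{-k}u)||k-\log u|^\nu,$$ $$\hat m_\nu(\phi)=\int_0^\infty\phi(u)\log^\nu u\,\frac{du}{u},\quad \hat M_\nu(\phi)=\int_0^\infty|\phi(u)||\log u|^\nu\frac{du}{u}.$$ Standing assumptions on the kernels: (K1) for every $u\in\mathbb{R}^+$, $\sum_{k\in\mathbb{Z}}\chi(e^{-k}u)=1$, and $\int_0^\infty\phi(u)\frac{du}{u}=1$; (K2) for the given $r$, $M_r(\chi)+\hat M_r(\phi)<\infty$ and $\lim_{\gamma\to\infty}\sum_{|k-\log u|>\gamma}|\chi(e^{-k}u)||k-\log u|^r=0$ uniformly in $u\in\mathbb{R}^+$. The Durrmeyer type exponential sampling series is, for $w>0$ and $x\in\mathbb{R}^+$, $$(I_w^{\chi,\phi}f)(x)=\sum_{k\in\mathbb{Z}}\chi(e^{-k}x^w)\,w\int_0^\infty\phi(e^{-k}t^w)f(t)\frac{dt}{t}.$$ The Mellin derivative is $\theta f(x)=xf'(x)$, with $\theta^1=\theta$ and $\theta^j=\theta(\theta^{j-1})$.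 The function $h$ is the one in the Mellin–Taylor formula at $x$: $f(t)-f(x)=\sum_{j=1}^r\frac{\theta^jf(x)}{j!}(\log t-\log x)^j+h(t/x)(\log t-\log x)^r$; it is a bounded function with $\lim_{y\to1}h(y)=0$.
   Formalization: The discrete moments are taken at x^w, i.e. m_η(χ,x^w) instead of the printed m_η(χ,x); the printed identity fails when m_η(χ,·) is not constant (e.g. r=1, a non-symmetric compactly supported partition of unity), and both forms agree when it is constant. *)

theory Defs
  imports "HOL-Analysis.Analysis" "HOL-Library.Landau_Symbols"
begin

(* Functions on the positive half-line are total functions on the reals;
   only their values on {0<..} ever matter. *)

definition mellin_measure :: "real measure" where
  "mellin_measure = density (lebesgue_on {0<..}) (\<lambda>t. ennreal (1 / t))"

definition moment :: "nat \<Rightarrow> (real \<Rightarrow> real) \<Rightarrow> real \<Rightarrow> real" where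
  "moment \<nu> chi u =
     (\<Sum>\<^sub>\<infinity>k\<in>(UNIV :: int set). chi (exp (- of_int k) * u) * (of_int k - ln u) ^ \<nu>)"

(* The absolute moments take values in [0, \<infinity>], so that finiteness is a genuine condition. *)

definition abs_moment :: "nat \<Rightarrow> (real \<Rightarrow> real) \<Rightarrow> ennreal" where
  "abs_moment \<nu> chi =
     (SUP u\<in>{0<..}. \<Sum>\<^sub>\<infinity>k\<in>(UNIV :: int set).
        ennreal (\<bar>chi (exp (- of_int k) * u)\<bar> * \<bar>of_int k - ln u\<bar> ^ \<nu>))"

definition cont_moment :: "nat \<Rightarrow> (real \<Rightarrow> real) \<Rightarrow> real" where
  "cont_moment \<nu> \<phi> = (LINT u|mellin_measure. \<phi> u * ln u ^ \<nu>)"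

definition cont_abs_moment :: "nat \<Rightarrow> (real \<Rightarrow> real) \<Rightarrow> ennreal" where
  "cont_abs_moment \<nu> \<phi> = (\<integral>\<^sup>+ u. ennreal (\<bar>\<phi> u\<bar> * \<bar>ln u\<bar> ^ \<nu>) \<partial>mellin_measure)"

definition tail_moment :: "nat \<Rightarrow> (real \<Rightarrow> real) \<Rightarrow> real \<Rightarrow> real \<Rightarrow> real" where
  "tail_moment \<nu> chi \<gamma> u =
     (\<Sum>\<^sub>\<infinity>k\<in>{k :: int. \<bar>of_int k - ln u\<bar> > \<gamma>}.
        \<bar>chi (exp (- of_int k) * u)\<bar> * \<bar>of_int k - ln u\<bar> ^ \<nu>)"

definition durrmeyer_series ::
    "(real \<Rightarrow> real) \<Rightarrow> (real \<Rightarrow> real) \<Rightarrow> real \<Rightarrow> (real \<Rightarrow> real) \<Rightarrow> real \<Rightarrow> real" where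
  "durrmeyer_series chi \<phi> w f x =
     (\<Sum>\<^sub>\<infinity>k\<in>(UNIV :: int set). chi (exp (- of_int k) * x powr w) *
        (w * (LINT t|mellin_measure. \<phi> (exp (- of_int k) * t powr w) * f t)))"

definition mellin_deriv :: "(real \<Rightarrow> real) \<Rightarrow> real \<Rightarrow> real" where
  "mellin_deriv f = (\<lambda>x. x * deriv f x)"

definition C_locally_at :: "nat \<Rightarrow> (real \<Rightarrow> real) \<Rightarrow> real \<Rightarrow> bool" where
  "C_locally_at r f x \<longleftrightarrow>
     bounded (f ` {0<..}) \<and> f \<in> borel_measurable (lebesgue_on {0<..}) \<and>
     (\<exists>U \<subseteq> {0<..}. open U \<and> x \<in> U \<and>
        (\<forall>j<r. (deriv ^^ j) f differentiable_on U) \<and> continuous_on U ((deriv ^^ r) f))"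

(* At t = x the equation reads 0 = 0 for r > 0, so the value h 1 is left free.  Boundedness of h on
   {0<..} and h y \<rightarrow> 0 as y \<rightarrow> 1 follow from C_locally_at r f x. *)

definition mellin_taylor_remainder ::
    "nat \<Rightarrow> (real \<Rightarrow> real) \<Rightarrow> real \<Rightarrow> (real \<Rightarrow> real) \<Rightarrow> bool" where
  "mellin_taylor_remainder r f x h \<longleftrightarrow>
     (\<forall>t>0. f t - f x =
        (\<Sum>j=1..r. (mellin_deriv ^^ j) f x / fact j * (ln t - ln x) ^ j) +
        h (t / x) * (ln t - ln x) ^ r)"

definition durrmeyer_remainder ::
    "(real \<Rightarrow> real) \<Rightarrow> (real \<Rightarrow> real) \<Rightarrow> (real \<Rightarrow> real) \<Rightarrow> nat \<Rightarrow> real \<Rightarrow> real \<Rightarrow> real" where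
  "durrmeyer_remainder chi \<phi> h r x w =
     (\<Sum>\<^sub>\<infinity>k\<in>(UNIV :: int set). chi (exp (- of_int k) * x powr w) *
        (w * (LINT t|mellin_measure.
           \<phi> (exp (- of_int k) * t powr w) * h (t / x) * (ln t - ln x) ^ r)))"

end

theory Submission
  imports Defs "HOL-Combinatorics.Stirling"
begin

text \<open>
  The measure \<open>dt/t\<close> is invariant under dilations, and the substitution \<open>s = e\<^sup>-\<^sup>k t\<^sup>w\<close> turns
  \<open>w dt/t\<close> into \<open>ds/s\<close>.  It moves the scale \<open>w\<close> from the kernel to the function: the \<open>k\<close>-th
  coefficient of the series becomes the integral of \<open>\<phi>(s) f(t)\<close> with
  \<open>ln t - ln x = (a + ln s) / w\<close>, where \<open>a = k - ln u\<close> and \<open>u = x\<^sup>w\<close>.  In this form the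
  Mellin-Taylor formula is a polynomial in \<open>(a + ln s) / w\<close> plus a remainder.  The binomial theorem
  separates \<open>a\<close> from \<open>ln s\<close>; integration in \<open>s\<close> produces the moments of \<open>\<phi>\<close>, summation over \<open>k\<close>
  against \<open>\<chi>(e\<^sup>-\<^sup>k u)\<close> the moments of \<open>\<chi>\<close>, and the two normalisations turn the constant term into
  \<open>f x\<close>.  This is \<open>durrmeyer_expansion\<close>.

  For the asymptotics, put \<open>v = ln t\<close>.  The \<open>m\<close>-th derivative of \<open>v \<mapsto> f(e\<^sup>v)\<close> is the \<open>m\<close>-th Mellin
  derivative of \<open>f\<close> at \<open>e\<^sup>v\<close>, so the Lagrange form of Taylor's theorem shows that \<open>h(e\<^sup>z)\<close> tends to 0
  as \<open>z\<close> tends to 0, and boundedness of \<open>f\<close> gives a bound \<open>H\<close> of \<open>h\<close> away from 1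
  (\<open>mellin_taylor_remainder_tendsto_0\<close>, \<open>mellin_taylor_remainder_bounded\<close>).  If \<open>\<bar>h(e\<^sup>z)\<bar> \<le> \<epsilon>\<close> for
  \<open>0 < \<bar>z\<bar> \<le> \<delta>\<close>, then with \<open>\<gamma> = w \<delta> / 2\<close>
  \<open>\<bar>h(e\<^sup>z)\<bar> \<le> \<epsilon> + H [\<bar>a\<bar> > \<gamma>] + H [\<bar>ln s\<bar> > \<gamma>]\<close> at every \<open>z = (a + ln s) / w \<noteq> 0\<close>, the brackets being
  indicators.  Together with \<open>\<bar>a + ln s\<bar>\<^sup>r \<le> 2\<^sup>r (\<bar>a\<bar>\<^sup>r + \<bar>ln s\<bar>\<^sup>r)\<close> this bounds \<open>w\<^sup>r\<close> times the remainder by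
  three contributions (\<open>remainder_series_bound\<close>): one proportional to \<open>\<epsilon>\<close>; one governed by the tail
  moment of \<open>\<chi>\<close>, which is small uniformly in \<open>u\<close> although \<open>u\<close> itself moves with \<open>w\<close>; and one governed
  by the tail integrals of \<open>\<phi>\<close>, which vanish by dominated convergence.
\<close>

section \<open>The multiplicative measure on the half-line\<close>

lemma space_mellin_measure [simp]: "space mellin_measure = {0<..}"
  by (simp add: mellin_measure_def)

lemma sets_mellin_measure [simp, measurable_cong]:
  "sets mellin_measure = sets (lebesgue_on {0<..})"
  by (simp add: mellin_measure_def)

lemma borel_measurable_mellin_measure:
  "borel_measurable mellin_measure = borel_measurable (lebesgue_on {0<..})"
  by (rule measurable_cong_sets) auto

text \<open>
  A function is Bochner integrable for a density only if it is measurable for the base measure.  This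
  equivalence lets integrability of \<open>g\<close> for \<open>dt/t\<close> and of \<open>g t / t\<close> for \<open>dt\<close> fail together when
  \<open>g\<close> is not measurable.
\<close>

lemma borel_measurable_mellin_div:
  fixes g :: "real \<Rightarrow> real"
  shows "(\<lambda>t. g t / t) \<in> borel_measurable (lebesgue_on {0<..}) \<longleftrightarrow>
         g \<in> borel_measurable (lebesgue_on {0<..})"
proof
  have id: "(\<lambda>t. t) \<in> borel_measurable (lebesgue_on {0::real<..})"
    by (intro measurable_restrict_space1 measurable_completion) simp
  show "(\<lambda>t. g t / t) \<in> borel_measurable (lebesgue_on {0<..})"
    if "g \<in> borel_measurable (lebesgue_on {0<..})"
    using that id by measurable
  assume "(\<lambda>t. g t / t) \<in> borel_measurable (lebesgue_on {0<..})"
  then have "(\<lambda>t. g t / t * t) \<in> borel_measurable (lebesgue_on {0<..})"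
    using id by measurable
  then show "g \<in> borel_measurable (lebesgue_on {0<..})"
    by (rule measurable_cong[THEN iffD1, rotated]) auto
qed

lemma
  fixes g :: "real \<Rightarrow> real"
  shows integrable_mellin_iff:
      "integrable mellin_measure g \<longleftrightarrow> (\<lambda>t. g t / t) absolutely_integrable_on {0<..}" (is ?int)
    and integral_mellin: "integrable mellin_measure g \<Longrightarrow>
      (LINT t|mellin_measure. g t) = integral {0<..} (\<lambda>t. g t / t)" (is "_ \<Longrightarrow> ?eq")
proof -
  have id: "(\<lambda>t. 1 / t) \<in> borel_measurable (lebesgue_on {0::real<..})"
    by (intro measurable_restrict_space1 measurable_completion) simp
  have pos: "AE t in lebesgue_on {0<..}. 0 \<le> 1 / (t::real)"
    by (rule AE_I2) auto
  show ?int
  proof (cases "g \<in> borel_measurable (lebesgue_on {0<..})")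
    case True
    then show ?thesis
      by (simp add: mellin_measure_def integrable_density[OF True id pos] set_integrable_def
          integrable_restrict_space)
  next
    case False
    then have "\<not> integrable mellin_measure g"
      using borel_measurable_integrable borel_measurable_mellin_measure by blast
    moreover have "\<not> (\<lambda>t. g t / t) absolutely_integrable_on {0<..}"
      using False borel_measurable_mellin_div[of g]
      by (auto simp: absolutely_integrable_on_def dest: integrable_imp_measurable)
    ultimately show ?thesis by simp
  qed
  assume g: "integrable mellin_measure g"
  then have "g \<in> borel_measurable (lebesgue_on {0<..})"
    using borel_measurable_integrable borel_measurable_mellin_measure by blast
  then have "(LINT t|mellin_measure. g t) = (LINT t|lebesgue_on {0<..}. g t / t)"
    by (simp add: mellin_measure_def integral_density[OF _ id pos])
  also have "\<dots> = integral {0<..} (\<lambda>t. g t / t)"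
    using \<open>?int\<close> g
    by (intro lebesgue_integral_eq_integral)
       (auto simp: set_integrable_def integrable_restrict_space)
  finally show ?eq .
qed

lemma bij_betw_mult_powr:
  fixes c w :: real
  assumes "c > 0" "w \<noteq> 0"
  shows "bij_betw (\<lambda>t. c * t powr w) {0<..} {0<..}"
  by (rule bij_betw_byWitness[where f' = "\<lambda>s. (s / c) powr (1 / w)"])
     (use assms in \<open>auto simp: powr_powr\<close>)

text \<open>
  Continuity is not enough here: for Lebesgue measurable functions to survive composition, preimages of
  null sets must be measurable.  The preimage of a set is its image under the inverse map, which is
  differentiable, and differentiable maps send Lebesgue measurable sets to such sets.
\<close>

lemma measurable_mult_powr:
  fixes c w :: real
  assumes "c > 0" "w \<noteq> 0"
  shows "(\<lambda>t. c * t powr w) \<in> measurable (lebesgue_on {0<..}) (lebesgue_on {0<..})"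
proof (rule measurableI)
  let ?\<tau> = "\<lambda>t::real. c * t powr w" and ?\<sigma> = "\<lambda>s::real. (s / c) powr (1 / w)"
  fix A :: "real set"
  assume "A \<in> sets (lebesgue_on {0<..})"
  then have A: "A \<in> sets lebesgue" "A \<subseteq> {0<..}"
    by (auto simp: sets_restrict_space)
  have "?\<tau> -` A \<inter> {0<..} = ?\<sigma> ` A"
  proof (intro equalityI subsetI)
    fix t assume "t \<in> ?\<tau> -` A \<inter> {0<..}"
    then have "?\<tau> t \<in> A" "t = ?\<sigma> (?\<tau> t)"
      using assms by (auto simp: powr_powr)
    then show "t \<in> ?\<sigma> ` A" by blast
  qed (use assms A in \<open>auto simp: powr_powr dest!: subsetD\<close>)
  moreover have "?\<sigma> ` A \<in> sets lebesgue"
  proof (rule differentiable_image_in_sets_lebesgue[OF A(1)])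
    show "?\<sigma> differentiable_on A"
      unfolding differentiable_on_def
    proof
      fix s assume "s \<in> A"
      then have "(?\<sigma> has_real_derivative
          (s / c) powr (1 / w - 1) * (1 / w) * (1 / c)) (at s within A)"
        using A assms by (auto intro!: derivative_eq_intros)
      then show "?\<sigma> differentiable at s within A"
        by (auto simp: real_differentiable_def)
    qed
  qed auto
  ultimately show "?\<tau> -` A \<inter> space (lebesgue_on {0<..}) \<in> sets (lebesgue_on {0<..})"
    by (auto simp: sets_restrict_space_iff)
qed (use assms in auto)

text \<open>
  For \<open>s = c t\<^sup>w\<close> one has \<open>ds/s = w dt/t\<close>: the constant \<open>c\<close> disappears and the exponent becomes a factor.
\<close>

lemma
  fixes g :: "real \<Rightarrow> real" and c w :: real
  assumes "c > 0" "w > 0"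
  shows integrable_mellin_mult_powr:
      "integrable mellin_measure (\<lambda>t. g (c * t powr w)) \<longleftrightarrow> integrable mellin_measure g" (is ?int)
    and integral_mellin_mult_powr:
      "w * (LINT t|mellin_measure. g (c * t powr w)) = (LINT s|mellin_measure. g s)" (is ?eq)
proof -
  let ?\<tau> = "\<lambda>t::real. c * t powr w" and ?\<tau>' = "\<lambda>t::real. c * (w * t powr (w - 1))"
  have cov: "(\<lambda>t. \<bar>?\<tau>' t\<bar> * (g (?\<tau> t) / ?\<tau> t)) absolutely_integrable_on {0<..} \<and>
      integral {0<..} (\<lambda>t. \<bar>?\<tau>' t\<bar> * (g (?\<tau> t) / ?\<tau> t)) = b
    \<longleftrightarrow> (\<lambda>s. g s / s) absolutely_integrable_on (?\<tau> ` {0<..}) \<and>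
      integral (?\<tau> ` {0<..}) (\<lambda>s. g s / s) = b" for b
    using assms bij_betw_mult_powr[of c w]
    by (intro has_absolute_integral_change_of_variables_1')
       (auto intro!: derivative_eq_intros simp: bij_betw_def)
  have img: "?\<tau> ` {0<..} = {0<..}"
    using bij_betw_mult_powr[of c w] assms by (simp add: bij_betw_def)
  have eq: "\<bar>?\<tau>' t\<bar> * (g (?\<tau> t) / ?\<tau> t) = (w * g (?\<tau> t)) / t" if "t \<in> {0<..}" for t
    using that assms by (auto simp: abs_mult powr_diff field_simps)
  have cov': "(\<lambda>t. (w * g (?\<tau> t)) / t) absolutely_integrable_on {0<..} \<and>
      integral {0<..} (\<lambda>t. (w * g (?\<tau> t)) / t) = b
    \<longleftrightarrow> (\<lambda>s. g s / s) absolutely_integrable_on {0<..} \<and> integral {0<..} (\<lambda>s. g s / s) = b" for b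
  proof -
    have "(\<lambda>t. \<bar>?\<tau>' t\<bar> * (g (?\<tau> t) / ?\<tau> t)) absolutely_integrable_on {0<..} \<longleftrightarrow>
        (\<lambda>t. (w * g (?\<tau> t)) / t) absolutely_integrable_on {0<..}"
      by (intro set_integrable_cong refl eq)
    moreover have "integral {0<..} (\<lambda>t. \<bar>?\<tau>' t\<bar> * (g (?\<tau> t) / ?\<tau> t)) =
        integral {0<..} (\<lambda>t. (w * g (?\<tau> t)) / t)"
      by (intro Henstock_Kurzweil_Integration.integral_cong eq)
    ultimately show ?thesis
      using cov[of b] unfolding img by (simp only:)
  qed
  have int': "integrable mellin_measure (\<lambda>t. w * g (?\<tau> t)) \<longleftrightarrow> integrable mellin_measure g"
    using cov' unfolding integrable_mellin_iff by blast
  moreover have "integrable mellin_measure (\<lambda>t. w * g (?\<tau> t)) \<longleftrightarrow>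
      integrable mellin_measure (\<lambda>t. g (?\<tau> t))"
    using assms by auto
  ultimately show ?int by simp
  show ?eq
  proof (cases "integrable mellin_measure g")
    case True
    have "w * (LINT t|mellin_measure. g (?\<tau> t)) = (LINT t|mellin_measure. w * g (?\<tau> t))"
      by simp
    also have "\<dots> = (LINT s|mellin_measure. g s)"
      using True int' cov' unfolding integrable_mellin_iff by (metis integral_mellin integrable_mellin_iff)
    finally show ?thesis .
  next
    case False
    then show ?thesis using \<open>?int\<close> by (simp add: not_integrable_integral_eq)
  qed
qed

section \<open>The remainder of the Mellin-Taylor formula\<close>

text \<open>
  Powers of \<open>t d/dt\<close> expand in the operators \<open>t\<^sup>i d\<^sup>i/dt\<^sup>i\<close> with Stirling numbers of the second kind,
  since \<open>t d/dt\<close> maps \<open>t\<^sup>i f\<^sup>(\<^sup>i\<^sup>)\<close> to \<open>i t\<^sup>i f\<^sup>(\<^sup>i\<^sup>) + t\<^sup>i\<^sup>+\<^sup>1 f\<^sup>(\<^sup>i\<^sup>+\<^sup>1\<^sup>)\<close>, which is their recurrence.  The formula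
  transfers the smoothness of \<open>f\<close>, given by ordinary derivatives, to its Mellin derivatives.
\<close>

lemma mellin_deriv_funpow_Stirling:
  fixes f :: "real \<Rightarrow> real"
  assumes U: "open U" and f: "\<forall>j<r. (deriv ^^ j) f differentiable_on U"
    and "j \<le> r" "t \<in> U"
  shows "(mellin_deriv ^^ j) f t = (\<Sum>i\<le>j. real (Stirling j i) * t ^ i * (deriv ^^ i) f t)"
  using \<open>j \<le> r\<close> \<open>t \<in> U\<close>
proof (induction j arbitrary: t)
  case (Suc j)
  let ?D = "\<lambda>i. (deriv ^^ i) f"
  have D: "(?D i has_real_derivative ?D (Suc i) t) (at t)" if "i \<le> j" for i
    using f that Suc.prems U
    by (auto simp: differentiable_on_eq_differentiable_at DERIV_deriv_iff_real_differentiable)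
  have "((\<lambda>t. \<Sum>i\<le>j. real (Stirling j i) * t ^ i * ?D i t) has_real_derivative
      (\<Sum>i\<le>j. real (Stirling j i) * (real i * t ^ (i - 1) * ?D i t + t ^ i * ?D (Suc i) t))) (at t)"
    by (auto intro!: derivative_eq_intros D sum.cong simp: algebra_simps)
  then have "((mellin_deriv ^^ j) f has_real_derivative
      (\<Sum>i\<le>j. real (Stirling j i) * (real i * t ^ (i - 1) * ?D i t + t ^ i * ?D (Suc i) t))) (at t)"
    by (rule has_field_derivative_transform_within_open[OF _ U])
       (use Suc in auto)
  then have "(mellin_deriv ^^ Suc j) f t =
      t * (\<Sum>i\<le>j. real (Stirling j i) * (real i * t ^ (i - 1) * ?D i t + t ^ i * ?D (Suc i) t))"
    by (simp add: mellin_deriv_def DERIV_imp_deriv)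
  also have "\<dots> = (\<Sum>i\<le>j. real (i * Stirling j i) * t ^ i * ?D i t) +
      (\<Sum>i\<le>j. real (Stirling j i) * t ^ Suc i * ?D (Suc i) t)"
    unfolding sum_distrib_left sum.distrib[symmetric]
  proof (intro sum.cong refl)
    fix i
    have "real i * (t * t ^ (i - 1)) = real i * t ^ i"
      by (cases i) auto
    then show "t * (real (Stirling j i) * (real i * t ^ (i - 1) * ?D i t + t ^ i * ?D (Suc i) t)) =
        real (i * Stirling j i) * t ^ i * ?D i t + real (Stirling j i) * t ^ Suc i * ?D (Suc i) t"
      by (auto simp: algebra_simps)
  qed
  \<comment> \<open>the sum may be extended to Suc j, where the Stirling number is 0, and then shifted,
      since its term at i = 0 is 0\<close>
  also have "(\<Sum>i\<le>j. real (i * Stirling j i) * t ^ i * ?D i t) =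
      (\<Sum>i\<le>Suc j. real (i * Stirling j i) * t ^ i * ?D i t)"
    by simp
  also have "\<dots> = (\<Sum>i\<le>j. real (Suc i * Stirling j (Suc i)) * t ^ Suc i * ?D (Suc i) t)"
    by (subst sum.atMost_Suc_shift) simp
  also have "\<dots> + (\<Sum>i\<le>j. real (Stirling j i) * t ^ Suc i * ?D (Suc i) t) =
      (\<Sum>i\<le>j. real (Stirling (Suc j) (Suc i)) * t ^ Suc i * ?D (Suc i) t)"
    by (simp add: sum.distrib[symmetric] algebra_simps)
  also have "\<dots> = (\<Sum>i\<le>Suc j. real (Stirling (Suc j) i) * t ^ i * ?D i t)"
    by (subst sum.atMost_Suc_shift) simp
  finally show ?case .
qed simp

lemma
  fixes f :: "real \<Rightarrow> real"
  assumes U: "open U" "U \<subseteq> {0<..}" and f: "\<forall>j<r. (deriv ^^ j) f differentiable_on U"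
  shows mellin_deriv_funpow_DERIV:
      "j < r \<Longrightarrow> t \<in> U \<Longrightarrow>
        ((mellin_deriv ^^ j) f has_real_derivative (mellin_deriv ^^ Suc j) f t / t) (at t)"
    and continuous_on_mellin_deriv_funpow:
      "continuous_on U ((deriv ^^ r) f) \<Longrightarrow> continuous_on U ((mellin_deriv ^^ r) f)"
proof -
  show "((mellin_deriv ^^ j) f has_real_derivative (mellin_deriv ^^ Suc j) f t / t) (at t)"
    if "j < r" "t \<in> U"
  proof -
    have "(\<lambda>t. \<Sum>i\<le>j. real (Stirling j i) * t ^ i * (deriv ^^ i) f t) differentiable_on U"
      using f \<open>j < r\<close> by (auto intro!: derivative_intros differentiable_on_mult differentiable_sum
          simp: differentiable_on_def)
    then obtain D where "((\<lambda>t. \<Sum>i\<le>j. real (Stirling j i) * t ^ i * (deriv ^^ i) f t)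
        has_real_derivative D) (at t)"
      unfolding differentiable_on_eq_differentiable_at[OF U(1)] real_differentiable_def
      using \<open>t \<in> U\<close> by blast
    then have D: "((mellin_deriv ^^ j) f has_real_derivative D) (at t)"
      by (rule has_field_derivative_transform_within_open[OF _ U(1)])
         (use that in \<open>auto simp: mellin_deriv_funpow_Stirling[OF U(1) f]\<close>)
    have "t > 0" using that U by auto
    then show ?thesis
      using D DERIV_imp_deriv[OF D] by (simp add: mellin_deriv_def)
  qed
  assume r: "continuous_on U ((deriv ^^ r) f)"
  have "continuous_on U ((deriv ^^ i) f)" if "i \<le> r" for i
    using r f that by (cases "i = r") (auto intro: differentiable_imp_continuous_on)
  then have "continuous_on U (\<lambda>t. \<Sum>i\<le>r. real (Stirling r i) * t ^ i * (deriv ^^ i) f t)"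
    by (auto intro!: continuous_intros)
  then show "continuous_on U ((mellin_deriv ^^ r) f)"
    by (rule continuous_on_cong[THEN iffD1, rotated -1])
       (auto simp: mellin_deriv_funpow_Stirling[OF U(1) f])
qed

text \<open>
  In the variable \<open>v = ln t\<close> the Mellin-Taylor formula is the ordinary Taylor formula of
  \<open>v \<mapsto> f(e\<^sup>v)\<close> at \<open>ln x\<close>.  Its Lagrange form identifies \<open>h(e\<^sup>z)\<close> with the increment of the \<open>r\<close>-th
  derivative between \<open>ln x\<close> and a point at distance less than \<open>\<bar>z\<bar>\<close>, divided by \<open>r!\<close>.
\<close>

lemma mellin_taylor_remainder_tendsto_0:
  assumes f: "C_locally_at r f x" and h: "mellin_taylor_remainder r f x h"
    and r: "r \<ge> 1" and x: "x > 0"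
  shows "((\<lambda>z. h (exp z)) \<longlongrightarrow> 0) (at 0)"
proof -
  obtain U where U: "U \<subseteq> {0<..}" "open U" "x \<in> U"
    and fU: "\<forall>j<r. (deriv ^^ j) f differentiable_on U" "continuous_on U ((deriv ^^ r) f)"
    using f unfolding C_locally_at_def by blast
  let ?F = "\<lambda>m v. (mellin_deriv ^^ m) f (exp v)"
  have "isCont ((mellin_deriv ^^ r) f) x"
    using continuous_on_mellin_deriv_funpow[OF U(2,1) fU] U
    by (simp add: continuous_on_eq_continuous_at)
  then have "isCont (?F r) (ln x)"
    using x by (intro isCont_o2[where g="(mellin_deriv ^^ r) f" and f=exp]) auto
  then have "(?F r \<longlongrightarrow> ?F r (ln x)) (nhds (ln x))"
    by (metis tendsto_at_iff_tendsto_nhds isCont_def)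
  moreover have "open (exp -` U)" "ln x \<in> exp -` U"
    using U x by (auto intro!: open_vimage continuous_intros)
  ultimately have near: "\<forall>\<^sub>F v in nhds (ln x). exp v \<in> U \<and> \<bar>?F r v - ?F r (ln x)\<bar> < e"
    if "e > 0" for e
    using that eventually_nhds_in_open[of "exp -` U" "ln x"]
    by (auto simp: tendsto_iff dist_real_def intro!: eventually_conj)
  show ?thesis
  proof (rule LIM_I)
    fix e :: real assume "e > 0"
    obtain d where d: "d > 0"
      "\<And>v. \<bar>v - ln x\<bar> < d \<Longrightarrow> exp v \<in> U \<and> \<bar>?F r v - ?F r (ln x)\<bar> < e"
      using near[OF \<open>e > 0\<close>] unfolding eventually_nhds_metric dist_real_def by auto
    \<comment> \<open>Taylor's theorem on the segment from ln x to ln x + z, with the point t = x * exp z\<close>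
    have "norm (h (exp z) - 0) < e" if z: "z \<noteq> 0" "norm (z - 0) < d" for z
    proof -
      let ?v = "ln x + z"
      have DERIV: "\<forall>m t. m < r \<and> min (ln x) ?v \<le> t \<and> t \<le> max (ln x) ?v \<longrightarrow>
          (?F m has_real_derivative ?F (Suc m) t) (at t)"
      proof (intro allI impI)
        fix m t assume t: "m < r \<and> min (ln x) ?v \<le> t \<and> t \<le> max (ln x) ?v"
        then have "\<bar>t - ln x\<bar> < d" using z by auto
        then have "exp t \<in> U" using d by blast
        then have "((mellin_deriv ^^ m) f has_real_derivative ?F (Suc m) t / exp t) (at (exp t))"
          using t by (intro mellin_deriv_funpow_DERIV[OF U(2,1) fU(1)]) auto
        from DERIV_chain2[OF this DERIV_exp] show "(?F m has_real_derivative ?F (Suc m) t) (at t)"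
          by simp
      qed
      obtain \<xi> where between: "if ?v < ln x then ?v < \<xi> \<and> \<xi> < ln x else ln x < \<xi> \<and> \<xi> < ?v"
        and eq: "f (exp ?v) = (\<Sum>m<r. ?F m (ln x) / fact m * (?v - ln x) ^ m) +
          ?F r \<xi> / fact r * (?v - ln x) ^ r"
        using Taylor[of r ?F "\<lambda>v. f (exp v)", OF _ _ DERIV, of "ln x" ?v] r z by auto
      have \<xi>: "\<bar>\<xi> - ln x\<bar> < \<bar>z\<bar>"
        using between by (auto split: if_splits)
      have "(\<Sum>m<r. ?F m (ln x) / fact m * z ^ m) = f x + (\<Sum>m=1..<r. ?F m (ln x) / fact m * z ^ m)"
        using r x by (simp add: lessThan_atLeast0 sum.atLeast_Suc_lessThan)
      moreover have "f (exp ?v) - f x = (\<Sum>j=1..r. (mellin_deriv ^^ j) f x / fact j * z ^ j) +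
          h (exp z) * z ^ r"
        using h x by (auto simp: mellin_taylor_remainder_def exp_add ln_mult)
      moreover have "{1..r} = insert r {1..<r}"
        using r by auto
      ultimately have "h (exp z) * z ^ r = (?F r \<xi> - ?F r (ln x)) / fact r * z ^ r"
        using eq x by (simp add: algebra_simps diff_divide_distrib)
      then have "h (exp z) = (?F r \<xi> - ?F r (ln x)) / fact r"
        by (subst (asm) mult_right_cancel) (use z in auto)
      then have "\<bar>h (exp z)\<bar> = \<bar>?F r \<xi> - ?F r (ln x)\<bar> / fact r"
        by simp
      also have "\<dots> \<le> \<bar>?F r \<xi> - ?F r (ln x)\<bar>"
        by (simp add: divide_le_eq mult_le_cancel_left1)
      also have "\<dots> < e"
        using d \<xi> z by auto
      finally show ?thesis by simp
    qed
    then show "\<exists>s>0. \<forall>z. z \<noteq> 0 \<and> norm (z - 0) < s \<longrightarrow> norm (h (exp z) - 0) < e"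
      using \<open>d > 0\<close> by blast
  qed
qed

text \<open>
  Near \<open>z = 0\<close> the limit gives a bound.  Elsewhere \<open>\<bar>z\<bar>\<close> is bounded below, and dividing the Mellin-Taylor
  formula by \<open>z\<^sup>r\<close> leaves a bounded numerator \<open>f t - f x\<close> and nonpositive powers of \<open>z\<close>.  The value of \<open>h\<close>
  at 1 is arbitrary, so \<open>z = 0\<close> has to be excluded.
\<close>

lemma mellin_taylor_remainder_bounded:
  assumes f: "C_locally_at r f x" and h: "mellin_taylor_remainder r f x h"
    and r: "r \<ge> 1" and x: "x > 0"
  obtains H where "H \<ge> 0" "\<And>z. z \<noteq> 0 \<Longrightarrow> \<bar>h (exp z)\<bar> \<le> H"
proof -
  obtain B where B: "\<And>t. t > 0 \<Longrightarrow> \<bar>f t\<bar> \<le> B"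
    using f by (auto simp: C_locally_at_def bounded_iff)
  obtain d where d: "d > 0" "\<And>z. z \<noteq> 0 \<Longrightarrow> \<bar>z\<bar> < d \<Longrightarrow> \<bar>h (exp z)\<bar> < 1"
    using LIM_D[OF mellin_taylor_remainder_tendsto_0[OF assms], of 1] by auto
  define c where "c j = (mellin_deriv ^^ j) f x / fact j" for j
  define H where "H = 1 + (2 * B / d ^ r + (\<Sum>j=1..r. \<bar>c j\<bar> / d ^ (r - j)))"
  have "B \<ge> 0" using B[of 1] by auto
  have far: "0 \<le> 2 * B / d ^ r + (\<Sum>j=1..r. \<bar>c j\<bar> / d ^ (r - j))"
    using \<open>B \<ge> 0\<close> d by (intro add_nonneg_nonneg sum_nonneg) auto
  show thesis
  proof (rule that[of H])
    show "H \<ge> 0" using far by (simp add: H_def)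
    fix z :: real assume z: "z \<noteq> 0"
    show "\<bar>h (exp z)\<bar> \<le> H"
    proof (cases "\<bar>z\<bar> < d")
      case True
      then show ?thesis using d z far by (force simp: H_def)
    next
      case False
      have "f (x * exp z) - f x = (\<Sum>j=1..r. c j * z ^ j) + h (exp z) * z ^ r"
        using h x by (auto simp: mellin_taylor_remainder_def c_def ln_mult)
      then have "h (exp z) = ((f (x * exp z) - f x) - (\<Sum>j=1..r. c j * z ^ j)) / z ^ r"
        using z by (simp add: field_simps)
      also have "\<dots> = (f (x * exp z) - f x) / z ^ r - (\<Sum>j=1..r. c j * z ^ j / z ^ r)"
        by (simp add: diff_divide_distrib sum_divide_distrib)
      also have "\<bar>\<dots>\<bar> \<le> \<bar>(f (x * exp z) - f x) / z ^ r\<bar> + (\<Sum>j=1..r. \<bar>c j * z ^ j / z ^ r\<bar>)"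
        by (rule order.trans[OF abs_triangle_ineq4]) (intro add_left_mono sum_abs)
      also have "\<dots> \<le> 2 * B / d ^ r + (\<Sum>j=1..r. \<bar>c j\<bar> / d ^ (r - j))"
      proof (intro add_mono sum_mono)
        have "\<bar>f (x * exp z) - f x\<bar> \<le> 2 * B"
          using B[of "x * exp z"] B[of x] x by auto
        then show "\<bar>(f (x * exp z) - f x) / z ^ r\<bar> \<le> 2 * B / d ^ r"
          using False d by (auto simp: power_abs abs_divide intro!: frac_le power_mono)
        fix j assume j: "j \<in> {1..r}"
        have "\<bar>c j * z ^ j / z ^ r\<bar> = \<bar>c j\<bar> / \<bar>z\<bar> ^ (r - j)"
          using j z by (simp add: abs_mult power_abs power_diff)
        also have "\<dots> \<le> \<bar>c j\<bar> / d ^ (r - j)"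
          using False d by (auto intro!: frac_le power_mono)
        finally show "\<bar>c j * z ^ j / z ^ r\<bar> \<le> \<bar>c j\<bar> / d ^ (r - j)" .
      qed
      finally show ?thesis by (simp add: H_def)
    qed
  qed
qed

section \<open>Moments of the kernels\<close>

lemma power_le_one_add_power:
  fixes a :: real
  assumes "0 \<le> a" "i \<le> n"
  shows "a ^ i \<le> 1 + a ^ n"
proof (cases "a \<le> 1")
  case True
  then have "a ^ i \<le> 1" using assms by (simp add: power_le_one)
  then show ?thesis using assms by (simp add: add_increasing2)
next
  case False
  then have "a ^ i \<le> a ^ n" using assms by (intro power_increasing) auto
  then show ?thesis by simp
qed

lemma abs_add_power_le:
  fixes a b :: real
  shows "\<bar>a + b\<bar> ^ n \<le> 2 ^ n * (\<bar>a\<bar> ^ n + \<bar>b\<bar> ^ n)"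
proof -
  have "\<bar>a + b\<bar> ^ n \<le> (2 * max \<bar>a\<bar> \<bar>b\<bar>) ^ n"
    by (intro power_mono) auto
  also have "\<dots> = 2 ^ n * max \<bar>a\<bar> \<bar>b\<bar> ^ n"
    by (simp add: power_mult_distrib)
  also have "\<dots> \<le> 2 ^ n * (\<bar>a\<bar> ^ n + \<bar>b\<bar> ^ n)"
    by (intro mult_left_mono) (auto simp: max_def)
  finally show ?thesis .
qed

lemma abs_moment_bounded:
  assumes "abs_moment r chi < \<infinity>"
  obtains M where "\<And>u. u > 0 \<Longrightarrow>
      (\<lambda>k::int. \<bar>chi (exp (- of_int k) * u)\<bar> * \<bar>of_int k - ln u\<bar> ^ r) summable_on UNIV"
    "\<And>u. u > 0 \<Longrightarrow>
      (\<Sum>\<^sub>\<infinity>k::int. \<bar>chi (exp (- of_int k) * u)\<bar> * \<bar>of_int k - ln u\<bar> ^ r) \<le> M"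
proof -
  define q where "q u k = \<bar>chi (exp (- of_int k) * u)\<bar> * \<bar>of_int k - ln u\<bar> ^ r" for u and k :: int
  let ?M = "enn2real (abs_moment r chi)"
  have le: "sum (q u) F \<le> ?M" if "u > 0" "finite F" for u F
  proof -
    have "ennreal (sum (q u) F) = (\<Sum>k\<in>F. ennreal (q u k))"
      by (intro sum_ennreal[symmetric]) (simp add: q_def)
    also have "\<dots> = (\<Sum>\<^sub>\<infinity>k\<in>F. ennreal (q u k))"
      using that by simp
    also have "\<dots> \<le> (\<Sum>\<^sub>\<infinity>k. ennreal (q u k))"
      by (intro infsum_mono_neutral nonneg_summable_on_complete) auto
    also have "\<dots> \<le> abs_moment r chi"
      unfolding abs_moment_def q_def using that by (intro SUP_upper) auto
    finally show ?thesis
      using assms by (metis enn2real_ennreal enn2real_mono infinity_ennreal_def sum_nonneg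
          q_def abs_ge_zero mult_nonneg_nonneg zero_le_power)
  qed
  have sm: "q u summable_on UNIV" if "u > 0" for u
    using le[OF that] by (intro nonneg_bdd_above_summable_on bdd_aboveI2[where M="?M"]) (auto simp: q_def)
  moreover have "infsum (q u) UNIV \<le> ?M" if "u > 0" for u
    using le[OF that] by (intro infsum_le_finite_sums sm that) auto
  ultimately show thesis
    unfolding q_def by (rule that)
qed

text \<open>
  Terms with \<open>\<bar>k - ln u\<bar> \<ge> 1\<close> are dominated by those of the \<open>r\<close>-th absolute moment.  At most two
  integers remain, and for them \<open>e\<^sup>-\<^sup>k u\<close> lies in the compact interval \<open>[1/e, e]\<close>, where \<open>\<chi>\<close> is bounded.
\<close>

lemma abs_kernel_sum_bounded:
  fixes chi :: "real \<Rightarrow> real"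
  assumes chi: "continuous_on {0<..} chi" and "abs_moment r chi < \<infinity>"
  obtains N where "\<And>u. u > 0 \<Longrightarrow> (\<lambda>k::int. \<bar>chi (exp (- of_int k) * u)\<bar>) summable_on UNIV"
    "\<And>u. u > 0 \<Longrightarrow> (\<Sum>\<^sub>\<infinity>k::int. \<bar>chi (exp (- of_int k) * u)\<bar>) \<le> N"
proof -
  obtain M where
    sm: "\<And>u. u > 0 \<Longrightarrow>
      (\<lambda>k::int. \<bar>chi (exp (- of_int k) * u)\<bar> * \<bar>of_int k - ln u\<bar> ^ r) summable_on UNIV" and
    M: "\<And>u. u > 0 \<Longrightarrow>
      (\<Sum>\<^sub>\<infinity>k::int. \<bar>chi (exp (- of_int k) * u)\<bar> * \<bar>of_int k - ln u\<bar> ^ r) \<le> M"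
    using abs_moment_bounded[OF assms(2)] by blast
  have "compact (chi ` {exp (-1)..exp 1})"
    by (intro compact_continuous_image continuous_on_subset[OF chi])
       (auto intro: less_le_trans[OF exp_gt_zero])
  then obtain C where C: "C > 0" "\<And>v. v \<in> {exp (-1)..exp 1} \<Longrightarrow> \<bar>chi v\<bar> \<le> C"
    by (auto dest!: compact_imp_bounded simp: bounded_pos)
  have le: "(\<Sum>k\<in>F. \<bar>chi (exp (- of_int k) * u)\<bar>) \<le> M + 2 * C"
    if u: "u > 0" and F: "finite F" for u and F :: "int set"
  proof -
    let ?q = "\<lambda>k::int. \<bar>chi (exp (- of_int k) * u)\<bar> * \<bar>of_int k - ln u\<bar> ^ r"
    let ?near = "{\<lfloor>ln u\<rfloor>..\<lfloor>ln u\<rfloor> + 1}"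
    have "\<bar>chi (exp (- of_int k) * u)\<bar> \<le> ?q k + (if k \<in> ?near then C else 0)" for k
    proof (cases "\<bar>of_int k - ln u\<bar> < 1")
      case True
      have "exp (- of_int k) * u = exp (ln u - of_int k)"
        using u by (simp add: exp_diff exp_minus field_simps)
      also have "\<dots> \<in> {exp (-1)..exp 1}"
        using True by auto
      finally have "\<bar>chi (exp (- of_int k) * u)\<bar> \<le> C"
        by (rule C(2))
      moreover have "k \<in> ?near"
        using True by (auto; linarith)
      ultimately show ?thesis by (simp add: add_increasing)
    next
      case False
      then have "1 \<le> \<bar>of_int k - ln u\<bar> ^ r" by simp
      then have "\<bar>chi (exp (- of_int k) * u)\<bar> * 1 \<le> ?q k"
        by (intro mult_left_mono) auto
      then show ?thesis using C by auto
    qed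
    then have "(\<Sum>k\<in>F. \<bar>chi (exp (- of_int k) * u)\<bar>) \<le>
        (\<Sum>k\<in>F. ?q k + (if k \<in> ?near then C else 0))"
      by (rule sum_mono)
    also have "\<dots> = sum ?q F + (\<Sum>k\<in>F \<inter> ?near. C)"
      by (simp only: sum.distrib sum.inter_restrict[OF F])
    also have "sum ?q F \<le> M"
      using finite_sum_le_infsum[OF sm[OF u] F] M[OF u] by force
    also have "(\<Sum>k\<in>F \<inter> ?near. C) \<le> (\<Sum>k\<in>?near. C)"
      using C by (intro sum_mono2) auto
    finally show ?thesis by simp
  qed
  have "(\<lambda>k::int. \<bar>chi (exp (- of_int k) * u)\<bar>) summable_on UNIV" if "u > 0" for u
    using le[OF that] by (intro nonneg_bdd_above_summable_on bdd_aboveI2[where M="M + 2 * C"]) auto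
  moreover from this have "(\<Sum>\<^sub>\<infinity>k::int. \<bar>chi (exp (- of_int k) * u)\<bar>) \<le> M + 2 * C" if "u > 0" for u
    using le[OF that] that by (intro infsum_le_finite_sums) auto
  ultimately show thesis using that by blast
qed

lemma moment_has_sum:
  fixes chi :: "real \<Rightarrow> real"
  assumes chi: "continuous_on {0<..} chi" and M: "abs_moment r chi < \<infinity>"
    and "i \<le> r" "u > 0"
  shows "((\<lambda>k::int. chi (exp (- of_int k) * u) * (of_int k - ln u) ^ i) has_sum moment i chi u) UNIV"
proof -
  have "(\<lambda>k::int. \<bar>chi (exp (- of_int k) * u)\<bar> + \<bar>chi (exp (- of_int k) * u)\<bar> * \<bar>of_int k - ln u\<bar> ^ r)
      summable_on UNIV"
  proof (rule summable_on_add)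
    show "(\<lambda>k::int. \<bar>chi (exp (- of_int k) * u)\<bar>) summable_on UNIV"
      by (rule abs_kernel_sum_bounded[OF chi M]) (use \<open>u > 0\<close> in blast)
    show "(\<lambda>k::int. \<bar>chi (exp (- of_int k) * u)\<bar> * \<bar>of_int k - ln u\<bar> ^ r) summable_on UNIV"
      by (rule abs_moment_bounded[OF M]) (use \<open>u > 0\<close> in blast)
  qed
  then have "(\<lambda>k::int. \<bar>chi (exp (- of_int k) * u) * (of_int k - ln u) ^ i\<bar>) summable_on UNIV"
  proof (rule summable_on_comparison_test)
    fix k :: int
    have "\<bar>chi (exp (- of_int k) * u)\<bar> * \<bar>of_int k - ln u\<bar> ^ i \<le>
        \<bar>chi (exp (- of_int k) * u)\<bar> * (1 + \<bar>of_int k - ln u\<bar> ^ r)"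
      using \<open>i \<le> r\<close> by (intro mult_left_mono power_le_one_add_power) auto
    then show "\<bar>chi (exp (- of_int k) * u) * (of_int k - ln u) ^ i\<bar> \<le>
        \<bar>chi (exp (- of_int k) * u)\<bar> + \<bar>chi (exp (- of_int k) * u)\<bar> * \<bar>of_int k - ln u\<bar> ^ r"
      by (simp add: abs_mult power_abs algebra_simps)
  qed auto
  then show ?thesis
    unfolding moment_def by (intro has_sum_infsum, subst summable_on_iff_abs_summable_on_real) simp
qed

lemma tail_moment_has_sum:
  assumes M: "abs_moment r chi < \<infinity>" and "u > 0"
  shows "((\<lambda>k::int. if \<bar>of_int k - ln u\<bar> > \<gamma>
      then \<bar>chi (exp (- of_int k) * u)\<bar> * \<bar>of_int k - ln u\<bar> ^ r else 0) has_sum tail_moment r chi \<gamma> u) UNIV"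
proof -
  let ?q = "\<lambda>k::int. \<bar>chi (exp (- of_int k) * u)\<bar> * \<bar>of_int k - ln u\<bar> ^ r"
  have "?q summable_on UNIV"
    by (rule abs_moment_bounded[OF M]) (use \<open>u > 0\<close> in blast)
  then have "?q summable_on {k. \<bar>of_int k - ln u\<bar> > \<gamma>}"
    by (rule summable_on_subset_banach) auto
  then have "(?q has_sum tail_moment r chi \<gamma> u) {k. \<bar>of_int k - ln u\<bar> > \<gamma>}"
    unfolding tail_moment_def by (rule has_sum_infsum)
  then show ?thesis
    by (rule has_sum_cong_neutral[THEN iffD1, rotated -1]) auto
qed

lemma borel_measurable_ln_mellin [measurable]: "ln \<in> borel_measurable mellin_measure"
  unfolding borel_measurable_mellin_measure
  by (intro measurable_restrict_space1 measurable_completion) simp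

lemma integrable_mellin_ln_power:
  assumes \<phi>: "integrable mellin_measure \<phi>" and "cont_abs_moment r \<phi> < \<infinity>" and "i \<le> r"
  shows "integrable mellin_measure (\<lambda>s. \<phi> s * ln s ^ i)"
proof -
  have [measurable]: "\<phi> \<in> borel_measurable mellin_measure"
    using \<phi> by simp
  have "integrable mellin_measure (\<lambda>s. \<phi> s * ln s ^ r)"
    using assms(2) by (intro integrableI_bounded) (auto simp: cont_abs_moment_def abs_mult power_abs)
  then have "integrable mellin_measure (\<lambda>s. \<bar>\<phi> s\<bar> + \<bar>\<phi> s * ln s ^ r\<bar>)"
    using \<phi> by simp
  then show ?thesis
  proof (rule Bochner_Integration.integrable_bound)
    show "AE s in mellin_measure. norm (\<phi> s * ln s ^ i) \<le> norm (\<bar>\<phi> s\<bar> + \<bar>\<phi> s * ln s ^ r\<bar>)"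
    proof (rule AE_I2)
      fix s :: real
      have "\<bar>\<phi> s\<bar> * \<bar>ln s\<bar> ^ i \<le> \<bar>\<phi> s\<bar> * (1 + \<bar>ln s\<bar> ^ r)"
        using \<open>i \<le> r\<close> by (intro mult_left_mono power_le_one_add_power) auto
      then show "norm (\<phi> s * ln s ^ i) \<le> norm (\<bar>\<phi> s\<bar> + \<bar>\<phi> s * ln s ^ r\<bar>)"
        by (simp add: abs_mult power_abs algebra_simps)
    qed
  qed simp
qed

text \<open>
  The binomial theorem splits a power of \<open>a + ln s\<close>, where \<open>a\<close> carries the summation index of the
  series, into powers of \<open>a\<close> with moments of \<open>\<phi>\<close> as coefficients.
\<close>

lemma
  assumes \<phi>: "integrable mellin_measure \<phi>" and M: "cont_abs_moment r \<phi> < \<infinity>" and "j \<le> r"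
  shows integrable_mellin_shifted_power: "integrable mellin_measure (\<lambda>s. \<phi> s * (a + ln s) ^ j)"
    and integral_mellin_shifted_power:
      "(LINT s|mellin_measure. \<phi> s * (a + ln s) ^ j) =
        (\<Sum>\<eta>=0..j. of_nat (j choose \<eta>) * cont_moment (j - \<eta>) \<phi> * a ^ \<eta>)"
proof -
  have eq: "\<phi> s * (a + ln s) ^ j =
      (\<Sum>\<eta>=0..j. (of_nat (j choose \<eta>) * a ^ \<eta>) * (\<phi> s * ln s ^ (j - \<eta>)))" for s
    by (simp add: binomial_ring sum_distrib_left mult_ac atLeast0AtMost)
  have int: "integrable mellin_measure (\<lambda>s. \<phi> s * ln s ^ (j - \<eta>))" for \<eta>
    using \<open>j \<le> r\<close> by (intro integrable_mellin_ln_power[OF \<phi> M]) auto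
  show "integrable mellin_measure (\<lambda>s. \<phi> s * (a + ln s) ^ j)"
    unfolding eq by (intro Bochner_Integration.integrable_sum integrable_mult_right int)
  have "(LINT s|mellin_measure. \<phi> s * (a + ln s) ^ j) = (\<Sum>\<eta>=0..j.
      LINT s|mellin_measure. (of_nat (j choose \<eta>) * a ^ \<eta>) * (\<phi> s * ln s ^ (j - \<eta>)))"
    unfolding eq by (intro Bochner_Integration.integral_sum integrable_mult_right int)
  also have "\<dots> = (\<Sum>\<eta>=0..j. (of_nat (j choose \<eta>) * a ^ \<eta>) * cont_moment (j - \<eta>) \<phi>)"
    by (simp only: cont_moment_def integral_mult_right_zero)
  finally show "(LINT s|mellin_measure. \<phi> s * (a + ln s) ^ j) =
      (\<Sum>\<eta>=0..j. of_nat (j choose \<eta>) * cont_moment (j - \<eta>) \<phi> * a ^ \<eta>)"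
    by (simp only: mult_ac)
qed

text \<open>
  The substitution \<open>s = e\<^sup>-\<^sup>\<kappa> t\<^sup>w\<close>: the kernel becomes independent of \<open>\<kappa>\<close> and \<open>w\<close>, which now act on
  the argument of \<open>G\<close> only.
\<close>

lemma integral_mellin_dilated_kernel:
  fixes \<phi> G :: "real \<Rightarrow> real" and w \<kappa> :: real
  assumes "w > 0"
  shows "w * (LINT t|mellin_measure. \<phi> (exp (- \<kappa>) * t powr w) * G t) =
    (LINT s|mellin_measure. \<phi> s * G (exp ((\<kappa> + ln s) / w)))"
proof -
  have "(LINT t|mellin_measure. \<phi> (exp (- \<kappa>) * t powr w) * G t) =
      (LINT t|mellin_measure. (\<lambda>s. \<phi> s * G (exp ((\<kappa> + ln s) / w))) (exp (- \<kappa>) * t powr w))"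
    using assms by (intro Bochner_Integration.integral_cong) (auto simp: ln_mult ln_powr)
  then show ?thesis
    using integral_mellin_mult_powr[of "exp (- \<kappa>)" w] assms by simp
qed

lemma borel_measurable_mellin_dilate:
  fixes f :: "real \<Rightarrow> real" and w \<kappa> :: real
  assumes f: "f \<in> borel_measurable (lebesgue_on {0<..})" and "w > 0"
  shows "(\<lambda>s. f (exp ((\<kappa> + ln s) / w))) \<in> borel_measurable mellin_measure"
proof -
  have "(\<lambda>s. f (exp (\<kappa> / w) * s powr (1 / w))) \<in> borel_measurable (lebesgue_on {0<..})"
    using measurable_comp[OF measurable_mult_powr f, of "exp (\<kappa> / w)" "1 / w"] assms
    by (simp add: o_def)
  also have "?this \<longleftrightarrow>
      (\<lambda>s. f (exp ((\<kappa> + ln s) / w))) \<in> borel_measurable (lebesgue_on {0<..})"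
  proof (rule measurable_cong)
    fix s :: real assume "s \<in> space (lebesgue_on {0<..})"
    then have "exp (\<kappa> / w) * s powr (1 / w) = exp ((\<kappa> + ln s) / w)"
      by (simp add: powr_def exp_add add_divide_distrib)
    then show "f (exp (\<kappa> / w) * s powr (1 / w)) = f (exp ((\<kappa> + ln s) / w))"
      by simp
  qed
  finally show ?thesis
    by (simp only: borel_measurable_mellin_measure)
qed

section \<open>The expansion\<close>

lemma has_sum_sum:
  fixes g :: "'b \<Rightarrow> 'a \<Rightarrow> 'c::topological_comm_monoid_add"
  assumes "\<And>j. j \<in> J \<Longrightarrow> (g j has_sum S j) A"
  shows "((\<lambda>k. \<Sum>j\<in>J. g j k) has_sum (\<Sum>j\<in>J. S j)) A"
  using assms by (induction J rule: infinite_finite_induct) (auto intro: has_sum_add)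

text \<open>
  Inserting the Mellin-Taylor formula at \<open>t = exp ((\<kappa> + ln s) / w)\<close> into a coefficient.  The
  integrand with \<open>h\<close> is measurable and integrable because it is the difference of \<open>\<phi>(s) f(t)\<close> and
  a polynomial in \<open>ln s\<close> times \<open>\<phi>\<close>.
\<close>

lemma
  fixes \<phi> f h :: "real \<Rightarrow> real" and x w \<kappa> :: real and r :: nat
  defines "a \<equiv> \<kappa> - w * ln x"
  assumes \<phi>: "integrable mellin_measure \<phi>" "(LINT s|mellin_measure. \<phi> s) = 1"
      "cont_abs_moment r \<phi> < \<infinity>"
    and x: "x > 0" and w: "w > 0"
    and f: "C_locally_at r f x" and h: "mellin_taylor_remainder r f x h"
  shows integrable_mellin_remainder:
      "integrable mellin_measure (\<lambda>s. \<phi> s * (h (exp ((a + ln s) / w)) * ((a + ln s) / w) ^ r))"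
        (is ?int)
    and integral_mellin_taylor_expansion:
      "(LINT s|mellin_measure. \<phi> s * (h (exp ((a + ln s) / w)) * ((a + ln s) / w) ^ r)) =
        (LINT s|mellin_measure. \<phi> s * f (exp ((\<kappa> + ln s) / w))) - f x -
        (\<Sum>j=1..r. (mellin_deriv ^^ j) f x / (fact j * w ^ j) *
          (\<Sum>\<eta>=0..j. of_nat (j choose \<eta>) * cont_moment (j - \<eta>) \<phi> * a ^ \<eta>))" (is ?eq)
proof -
  let ?R = "\<lambda>s. \<phi> s * (h (exp ((a + ln s) / w)) * ((a + ln s) / w) ^ r)"
  let ?c = "\<lambda>j. (mellin_deriv ^^ j) f x / (fact j * w ^ j)"
  let ?S = "\<lambda>s. \<phi> s * f (exp ((\<kappa> + ln s) / w)) - f x * \<phi> s -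
      (\<Sum>j=1..r. ?c j * (\<phi> s * (a + ln s) ^ j))"
  have eq: "?R s = ?S s" for s
  proof -
    let ?t = "exp ((\<kappa> + ln s) / w)" and ?z = "(a + ln s) / w"
    have ln: "ln ?t - ln x = ?z"
      using w by (simp add: a_def field_simps)
    then have tx: "?t / x = exp ?z"
      using x by (metis exp_diff exp_ln ln_exp)
    have "f ?t - f x = (\<Sum>j=1..r. (mellin_deriv ^^ j) f x / fact j * ?z ^ j) + h (exp ?z) * ?z ^ r"
      using h[unfolded mellin_taylor_remainder_def, rule_format, of ?t] unfolding ln tx by simp
    moreover have "(\<Sum>j=1..r. (mellin_deriv ^^ j) f x / fact j * ?z ^ j) =
        (\<Sum>j=1..r. ?c j * (a + ln s) ^ j)"
      by (simp add: power_divide)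
    ultimately have "?R s = \<phi> s * (f ?t - f x - (\<Sum>j=1..r. ?c j * (a + ln s) ^ j))"
      by simp
    then show ?thesis
      by (simp add: algebra_simps sum_distrib_left)
  qed
  have f_meas: "(\<lambda>s. f (exp ((\<kappa> + ln s) / w))) \<in> borel_measurable mellin_measure"
    using f w by (intro borel_measurable_mellin_dilate) (auto simp: C_locally_at_def)
  obtain B where B: "\<And>t. t > 0 \<Longrightarrow> \<bar>f t\<bar> \<le> B"
    using f by (auto simp: C_locally_at_def bounded_iff)
  have int_f: "integrable mellin_measure (\<lambda>s. \<phi> s * f (exp ((\<kappa> + ln s) / w)))"
  proof (rule Bochner_Integration.integrable_bound)
    show "integrable mellin_measure (\<lambda>s. B * \<phi> s)"
      using \<phi> by simp
    show "(\<lambda>s. \<phi> s * f (exp ((\<kappa> + ln s) / w))) \<in> borel_measurable mellin_measure"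
      using \<phi>(1) f_meas by (intro borel_measurable_times) auto
    show "AE s in mellin_measure. norm (\<phi> s * f (exp ((\<kappa> + ln s) / w))) \<le> norm (B * \<phi> s)"
    proof (rule AE_I2)
      fix s :: real
      have "\<bar>f (exp ((\<kappa> + ln s) / w))\<bar> \<le> \<bar>B\<bar>"
        using B[of "exp ((\<kappa> + ln s) / w)"] by auto
      then have "\<bar>f (exp ((\<kappa> + ln s) / w))\<bar> * \<bar>\<phi> s\<bar> \<le> \<bar>B\<bar> * \<bar>\<phi> s\<bar>"
        by (rule mult_right_mono) simp
      then show "norm (\<phi> s * f (exp ((\<kappa> + ln s) / w))) \<le> norm (B * \<phi> s)"
        by (simp add: abs_mult mult.commute)
    qed
  qed
  have int_p: "integrable mellin_measure (\<lambda>s. ?c j * (\<phi> s * (a + ln s) ^ j))" if "j \<in> {1..r}" for j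
    using that by (intro integrable_mult_right integrable_mellin_shifted_power[OF \<phi>(1,3)]) auto
  have int_\<phi>: "integrable mellin_measure (\<lambda>s. f x * \<phi> s)"
    using \<phi> by simp
  have int_fd: "integrable mellin_measure (\<lambda>s. \<phi> s * f (exp ((\<kappa> + ln s) / w)) - f x * \<phi> s)"
    by (intro Bochner_Integration.integrable_diff int_f int_\<phi>)
  show ?int
    unfolding eq
    by (intro Bochner_Integration.integrable_diff Bochner_Integration.integrable_sum int_fd int_p)
  have "(LINT s|mellin_measure. ?S s) =
      (LINT s|mellin_measure. \<phi> s * f (exp ((\<kappa> + ln s) / w)) - f x * \<phi> s) -
      (LINT s|mellin_measure. (\<Sum>j=1..r. ?c j * (\<phi> s * (a + ln s) ^ j)))"
    by (intro Bochner_Integration.integral_diff Bochner_Integration.integrable_sum int_fd int_p)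
  also have "(LINT s|mellin_measure. \<phi> s * f (exp ((\<kappa> + ln s) / w)) - f x * \<phi> s) =
      (LINT s|mellin_measure. \<phi> s * f (exp ((\<kappa> + ln s) / w))) - f x"
    using Bochner_Integration.integral_diff[OF int_f int_\<phi>] \<phi>(2) by simp
  also have "(LINT s|mellin_measure. (\<Sum>j=1..r. ?c j * (\<phi> s * (a + ln s) ^ j))) =
      (\<Sum>j=1..r. LINT s|mellin_measure. ?c j * (\<phi> s * (a + ln s) ^ j))"
    by (intro Bochner_Integration.integral_sum int_p)
  also have "\<dots> = (\<Sum>j=1..r. ?c j *
      (\<Sum>\<eta>=0..j. of_nat (j choose \<eta>) * cont_moment (j - \<eta>) \<phi> * a ^ \<eta>))"
    using integral_mellin_shifted_power[OF \<phi>(1,3)]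
    by (intro sum.cong refl) (simp only: integral_mult_right_zero atLeastAtMost_iff)
  finally show ?eq
    unfolding eq .
qed

lemma durrmeyer_remainder_eq:
  fixes chi \<phi> h :: "real \<Rightarrow> real" and x w :: real
  assumes "x > 0" "w > 0"
  shows "durrmeyer_remainder chi \<phi> h r x w =
    (\<Sum>\<^sub>\<infinity>k::int. chi (exp (- of_int k) * x powr w) *
      (LINT s|mellin_measure. \<phi> s *
        (h (exp ((of_int k - w * ln x + ln s) / w)) * ((of_int k - w * ln x + ln s) / w) ^ r)))"
proof -
  have "w * (LINT t|mellin_measure. \<phi> (exp (- \<kappa>) * t powr w) * h (t / x) * (ln t - ln x) ^ r) =
    (LINT s|mellin_measure. \<phi> s *
      (h (exp ((\<kappa> - w * ln x + ln s) / w)) * ((\<kappa> - w * ln x + ln s) / w) ^ r))" for \<kappa>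
  proof -
    have "ln (exp ((\<kappa> + ln s) / w)) - ln x = (\<kappa> - w * ln x + ln s) / w" for s
      using assms by (simp add: field_simps)
    moreover from this have "exp ((\<kappa> + ln s) / w) / x = exp ((\<kappa> - w * ln x + ln s) / w)" for s
      using assms by (metis exp_diff exp_ln ln_exp)
    ultimately show ?thesis
      using integral_mellin_dilated_kernel[OF assms(2), of \<phi> \<kappa> "\<lambda>t. h (t / x) * (ln t - ln x) ^ r"]
      by (simp only: mult.assoc)
  qed
  then show ?thesis
    by (simp only: durrmeyer_remainder_def)
qed

text \<open>
  Summation of the expansions of the coefficients.  The series of \<open>f\<close> converges since \<open>f\<close> is bounded
  and the series of moments converge up to order \<open>r\<close>, so the remainder terms are summable as a difference.
\<close>

lemma durrmeyer_expansion:
  fixes chi \<phi> f h :: "real \<Rightarrow> real" and r :: nat and x w :: real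
  assumes chi: "continuous_on {0<..} chi" "abs_moment r chi < \<infinity>"
    and chi_sum: "\<And>u. u > 0 \<Longrightarrow> ((\<lambda>k::int. chi (exp (- of_int k) * u)) has_sum 1) UNIV"
    and \<phi>: "integrable mellin_measure \<phi>" "(LINT s|mellin_measure. \<phi> s) = 1"
      "cont_abs_moment r \<phi> < \<infinity>"
    and x: "x > 0" and w: "w > 0"
    and f: "C_locally_at r f x" and h: "mellin_taylor_remainder r f x h"
  shows "((\<lambda>k::int. chi (exp (- of_int k) * x powr w) *
      (LINT s|mellin_measure. \<phi> s *
        (h (exp ((of_int k - w * ln x + ln s) / w)) * ((of_int k - w * ln x + ln s) / w) ^ r)))
    has_sum (durrmeyer_series chi \<phi> w f x - f x -
      (\<Sum>j=1..r. (mellin_deriv ^^ j) f x / (fact j * w ^ j) *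
        (\<Sum>\<eta>=0..j. of_nat (j choose \<eta>) * cont_moment (j - \<eta>) \<phi> * moment \<eta> chi (x powr w))))) UNIV"
proof -
  let ?u = "x powr w"
  let ?\<chi> = "\<lambda>k::int. chi (exp (- of_int k) * ?u)"
  let ?a = "\<lambda>k::int. of_int k - w * ln x"
  let ?I = "\<lambda>k::int. LINT s|mellin_measure. \<phi> s * f (exp ((of_int k + ln s) / w))"
  let ?c = "\<lambda>j. (mellin_deriv ^^ j) f x / (fact j * w ^ j)"
  let ?m = "\<lambda>j \<eta>. of_nat (j choose \<eta>) * cont_moment (j - \<eta>) \<phi>"
  have u: "?u > 0" "ln ?u = w * ln x"
    using x by (auto simp: ln_powr)
  obtain B where B: "\<And>t. t > 0 \<Longrightarrow> \<bar>f t\<bar> \<le> B"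
    using f by (auto simp: C_locally_at_def bounded_iff)
  have I: "\<bar>?I k\<bar> \<le> (LINT s|mellin_measure. B * \<bar>\<phi> s\<bar>)" for k
  proof -
    have "norm (?I k) \<le> (LINT s|mellin_measure. norm (\<phi> s * f (exp ((of_int k + ln s) / w))))"
      by (rule integral_norm_bound)
    also have "\<dots> \<le> (LINT s|mellin_measure. B * \<bar>\<phi> s\<bar>)"
    proof (rule integral_mono')
      show "integrable mellin_measure (\<lambda>s. B * \<bar>\<phi> s\<bar>)"
        using \<phi> by simp
      show "norm (\<phi> s * f (exp ((of_int k + ln s) / w))) \<le> B * \<bar>\<phi> s\<bar>" for s
        using mult_right_mono[OF B, of "exp ((of_int k + ln s) / w)" "\<bar>\<phi> s\<bar>"]
        by (simp add: abs_mult mult.commute)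
      show "0 \<le> B * \<bar>\<phi> s\<bar>" for s
        using B[of 1] by simp
    qed
    finally show ?thesis by simp
  qed
  have series: "((\<lambda>k. ?\<chi> k * ?I k) has_sum durrmeyer_series chi \<phi> w f x) UNIV"
  proof -
    have "(\<lambda>k. \<bar>?\<chi> k\<bar>) summable_on UNIV"
      by (rule abs_kernel_sum_bounded[OF chi]) (use u in blast)
    then have "(\<lambda>k. (LINT s|mellin_measure. B * \<bar>\<phi> s\<bar>) * \<bar>?\<chi> k\<bar>) summable_on UNIV"
      by (rule summable_on_cmult_right)
    then have "(\<lambda>k. \<bar>?\<chi> k * ?I k\<bar>) summable_on UNIV"
    proof (rule summable_on_comparison_test)
      show "\<bar>?\<chi> k * ?I k\<bar> \<le> (LINT s|mellin_measure. B * \<bar>\<phi> s\<bar>) * \<bar>?\<chi> k\<bar>" for k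
        using mult_right_mono[OF I[of k], of "\<bar>?\<chi> k\<bar>"] by (simp add: abs_mult mult.commute)
    qed auto
    then have "(\<lambda>k. ?\<chi> k * ?I k) summable_on UNIV"
      by (subst summable_on_iff_abs_summable_on_real) simp
    then show ?thesis
      unfolding durrmeyer_series_def integral_mellin_dilated_kernel[OF w] by (rule has_sum_infsum)
  qed
  have poly: "((\<lambda>k. \<Sum>j=1..r. ?c j * (\<Sum>\<eta>=0..j. ?m j \<eta> * (?\<chi> k * ?a k ^ \<eta>))) has_sum
      (\<Sum>j=1..r. ?c j * (\<Sum>\<eta>=0..j. ?m j \<eta> * moment \<eta> chi ?u))) UNIV"
    using moment_has_sum[OF chi _ u(1)] unfolding u(2)
    by (intro has_sum_sum has_sum_cmult_right) auto
  have "((\<lambda>k. ?\<chi> k * ?I k + (- f x) * ?\<chi> k +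
        (- 1) * (\<Sum>j=1..r. ?c j * (\<Sum>\<eta>=0..j. ?m j \<eta> * (?\<chi> k * ?a k ^ \<eta>)))) has_sum
      (durrmeyer_series chi \<phi> w f x + (- f x) * 1 +
        (- 1) * (\<Sum>j=1..r. ?c j * (\<Sum>\<eta>=0..j. ?m j \<eta> * moment \<eta> chi ?u)))) UNIV"
    by (intro has_sum_add has_sum_cmult_right series poly chi_sum u)
  moreover have "?\<chi> k * ?I k + (- f x) * ?\<chi> k +
        (- 1) * (\<Sum>j=1..r. ?c j * (\<Sum>\<eta>=0..j. ?m j \<eta> * (?\<chi> k * ?a k ^ \<eta>))) =
      ?\<chi> k * (LINT s|mellin_measure. \<phi> s *
        (h (exp ((?a k + ln s) / w)) * ((?a k + ln s) / w) ^ r))" for k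
  proof -
    have "(\<Sum>j=1..r. ?c j * (\<Sum>\<eta>=0..j. ?m j \<eta> * (?\<chi> k * ?a k ^ \<eta>))) =
        ?\<chi> k * (\<Sum>j=1..r. ?c j * (\<Sum>\<eta>=0..j. ?m j \<eta> * ?a k ^ \<eta>))"
      unfolding sum_distrib_left by (intro sum.cong refl) (simp only: mult_ac)
    then show ?thesis
      unfolding integral_mellin_taylor_expansion[OF \<phi> x w f h]
      by (simp only: right_diff_distrib) simp
  qed
  ultimately show ?thesis
    by simp
qed

section \<open>The size of the remainder\<close>

text \<open>
  The truncated functions tend to 0 pointwise and are dominated by \<open>\<bar>q\<bar>\<close>.
\<close>

lemma
  fixes q :: "real \<Rightarrow> real"
  assumes q: "integrable mellin_measure q"
  shows integrable_log_tail: "integrable mellin_measure (\<lambda>s. if \<bar>ln s\<bar> > \<gamma> then q s else 0)"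
    and tendsto_log_tail:
      "((\<lambda>\<gamma>. LINT s|mellin_measure. (if \<bar>ln s\<bar> > \<gamma> then q s else 0)) \<longlongrightarrow> 0) at_top"
proof -
  have [measurable]: "q \<in> borel_measurable mellin_measure"
    using q by simp
  have meas: "(\<lambda>s. if \<bar>ln s\<bar> > \<gamma> then q s else 0) \<in> borel_measurable mellin_measure" for \<gamma>
    by measurable
  show "integrable mellin_measure (\<lambda>s. if \<bar>ln s\<bar> > \<gamma> then q s else 0)"
    by (rule Bochner_Integration.integrable_bound[OF q meas]) auto
  have "((\<lambda>\<gamma>. LINT s|mellin_measure. (if \<bar>ln s\<bar> > \<gamma> then q s else 0)) \<longlongrightarrow>
      (LINT s|mellin_measure. 0)) at_top"
  proof (rule integral_dominated_convergence_at_top)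
    show "integrable mellin_measure (\<lambda>s. \<bar>q s\<bar>)"
      using q by simp
    show "AE s in mellin_measure. ((\<lambda>\<gamma>. if \<bar>ln s\<bar> > \<gamma> then q s else 0) \<longlongrightarrow> 0) at_top"
    proof (rule AE_I2, rule tendsto_eventually)
      show "\<forall>\<^sub>F \<gamma> in at_top. (if \<bar>ln s\<bar> > \<gamma> then q s else 0) = 0" for s
        using eventually_ge_at_top[of "\<bar>ln s\<bar>"] by eventually_elim auto
    qed
  qed (auto intro: meas)
  then show "((\<lambda>\<gamma>. LINT s|mellin_measure. (if \<bar>ln s\<bar> > \<gamma> then q s else 0)) \<longlongrightarrow> 0) at_top"
    by simp
qed

text \<open>
  If \<open>\<bar>a\<bar> \<le> \<gamma>\<close> and \<open>\<bar>ln s\<bar> \<le> \<gamma>\<close> then \<open>\<bar>a + ln s\<bar> / w \<le> \<delta>\<close>, where \<open>g\<close> is at most \<open>\<epsilon>\<close>; otherwise one of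
  the two tail indicators equals 1 and pays for the global bound \<open>H\<close>.  Keeping the indicators
  additive separates the tail in \<open>a\<close>, to be summed over \<open>k\<close>, from the tail in \<open>s\<close>.
\<close>

lemma remainder_coefficient_bound:
  fixes \<phi> g :: "real \<Rightarrow> real" and a w \<delta> \<epsilon> H :: real and r :: nat
  defines "\<gamma> \<equiv> w * (\<delta> / 2)"
  assumes \<phi>: "integrable mellin_measure \<phi>" "cont_abs_moment r \<phi> < \<infinity>"
    and int: "integrable mellin_measure (\<lambda>s. \<phi> s * (g ((a + ln s) / w) * ((a + ln s) / w) ^ r))"
    and w: "w > 0" and \<epsilon>: "\<epsilon> \<ge> 0" and H: "H \<ge> 0" and r: "r \<ge> 1"
    and g_near: "\<And>z. z \<noteq> 0 \<Longrightarrow> \<bar>z\<bar> \<le> \<delta> \<Longrightarrow> \<bar>g z\<bar> \<le> \<epsilon>"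
    and g_bdd: "\<And>z. z \<noteq> 0 \<Longrightarrow> \<bar>g z\<bar> \<le> H"
  shows "\<bar>LINT s|mellin_measure. \<phi> s * (g ((a + ln s) / w) * ((a + ln s) / w) ^ r)\<bar> \<le>
    (2 / w) ^ r *
      ((\<epsilon> + (if \<bar>a\<bar> > \<gamma> then H else 0)) *
         ((LINT s|mellin_measure. \<bar>\<phi> s\<bar>) * \<bar>a\<bar> ^ r + (LINT s|mellin_measure. \<bar>\<phi> s * ln s ^ r\<bar>)) +
       H * ((LINT s|mellin_measure. (if \<bar>ln s\<bar> > \<gamma> then \<bar>\<phi> s\<bar> else 0)) * \<bar>a\<bar> ^ r +
         (LINT s|mellin_measure. (if \<bar>ln s\<bar> > \<gamma> then \<bar>\<phi> s * ln s ^ r\<bar> else 0))))"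
proof -
  let ?e = "\<epsilon> + (if \<bar>a\<bar> > \<gamma> then H else 0)"
  let ?A0 = "\<lambda>s. \<bar>\<phi> s\<bar>" and ?Ar = "\<lambda>s. \<bar>\<phi> s * ln s ^ r\<bar>"
  let ?T = "\<lambda>q s. if \<bar>ln s\<bar> > \<gamma> then q s else (0::real)"
  have A0: "integrable mellin_measure ?A0" and Ar: "integrable mellin_measure ?Ar"
    using integrable_mellin_ln_power[OF \<phi>, of r] \<phi> by auto
  note T0 = integrable_log_tail[OF A0, of \<gamma>] and Tr = integrable_log_tail[OF Ar, of \<gamma>]
  let ?G = "\<lambda>s. (2 / w) ^ r * (?e * (?A0 s * \<bar>a\<bar> ^ r + ?Ar s) + H * (?T ?A0 s * \<bar>a\<bar> ^ r + ?T ?Ar s))"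
  have "norm (LINT s|mellin_measure. \<phi> s * (g ((a + ln s) / w) * ((a + ln s) / w) ^ r)) \<le>
      (LINT s|mellin_measure. ?G s)"
  proof (rule Bochner_Integration.integral_norm_bound_integral[OF int])
    show "integrable mellin_measure ?G"
      by (intro integrable_mult_right Bochner_Integration.integrable_add integrable_mult_left A0 Ar T0 Tr)
    fix s :: real
    let ?z = "(a + ln s) / w"
    let ?E = "?e + (if \<bar>ln s\<bar> > \<gamma> then H else 0)"
    have "\<bar>g ?z\<bar> * \<bar>?z\<bar> ^ r \<le> ?E * \<bar>?z\<bar> ^ r"
    proof (cases "?z = 0")
      case True
      \<comment> \<open>g is not controlled at 0, but the factor vanishes there\<close>
      then have "\<bar>?z\<bar> ^ r = 0" unfolding True using r by simp
      then show ?thesis by (simp only: mult_zero_right order.refl)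
    next
      case False
      have "\<bar>g ?z\<bar> \<le> ?E"
      proof (cases "\<bar>a\<bar> \<le> \<gamma> \<and> \<bar>ln s\<bar> \<le> \<gamma>")
        case True
        then have "\<bar>a + ln s\<bar> \<le> w * \<delta>"
          unfolding \<gamma>_def by linarith
        then have "\<bar>?z\<bar> \<le> \<delta>"
          using w by (simp add: abs_divide divide_le_eq mult.commute)
        then show ?thesis using g_near[OF False] True by simp
      next
        case False': False
        then show ?thesis using g_bdd[OF False] \<epsilon> H by auto
      qed
      then show ?thesis by (rule mult_right_mono) simp
    qed
    also have "\<bar>?z\<bar> ^ r = \<bar>a + ln s\<bar> ^ r / w ^ r"
      using w by (simp add: power_divide abs_divide)
    also have "?E * (\<bar>a + ln s\<bar> ^ r / w ^ r) \<le> ?E * (2 ^ r * (\<bar>a\<bar> ^ r + \<bar>ln s\<bar> ^ r) / w ^ r)"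
      using w \<epsilon> H by (intro mult_left_mono divide_right_mono abs_add_power_le) auto
    finally have "\<bar>\<phi> s\<bar> * (\<bar>g ?z\<bar> * (\<bar>a + ln s\<bar> ^ r / w ^ r)) \<le>
        \<bar>\<phi> s\<bar> * (?E * (2 ^ r * (\<bar>a\<bar> ^ r + \<bar>ln s\<bar> ^ r) / w ^ r))"
      by (rule mult_left_mono) simp
    also have "\<dots> = ?G s"
      by (simp add: abs_mult power_abs power_divide algebra_simps add_divide_distrib)
    finally show "norm (\<phi> s * (g ?z * ?z ^ r)) \<le> ?G s"
      using w by (simp add: abs_mult power_abs power_divide abs_divide)
  qed
  also have "(LINT s|mellin_measure. ?G s) = (2 / w) ^ r *
      (?e * ((LINT s|mellin_measure. ?A0 s) * \<bar>a\<bar> ^ r + (LINT s|mellin_measure. ?Ar s)) +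
       H * ((LINT s|mellin_measure. ?T ?A0 s) * \<bar>a\<bar> ^ r + (LINT s|mellin_measure. ?T ?Ar s)))"
    using A0 Ar T0 Tr by (simp only: integral_mult_right_zero integral_mult_left_zero
        Bochner_Integration.integral_add integrable_mult_right integrable_mult_left
        Bochner_Integration.integrable_add)
  finally show ?thesis
    by simp
qed

text \<open>
  Summing the bounds of the coefficients against \<open>\<bar>\<chi>\<bar>\<close>.  On the tail \<open>\<bar>a\<bar> > \<gamma> \<ge> 1\<close> one has
  \<open>1 \<le> \<bar>a\<bar>\<^sup>r\<close>, so the tail moment of order \<open>r\<close> controls both the powers \<open>\<bar>a\<bar>\<^sup>r\<close> and the constants.
  All constants other than the tail moment are independent of \<open>u\<close>, which depends on \<open>w\<close> in
  the application.
\<close>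

lemma remainder_series_bound:
  fixes chi \<phi> g :: "real \<Rightarrow> real" and u w \<delta> \<epsilon> H :: real and r :: nat
  defines "\<gamma> \<equiv> w * (\<delta> / 2)"
  assumes chi: "abs_moment r chi < \<infinity>"
    and u: "u > 0"
    and N: "(\<lambda>k::int. \<bar>chi (exp (- of_int k) * u)\<bar>) summable_on UNIV"
      "(\<Sum>\<^sub>\<infinity>k::int. \<bar>chi (exp (- of_int k) * u)\<bar>) \<le> N"
    and M: "(\<lambda>k::int. \<bar>chi (exp (- of_int k) * u)\<bar> * \<bar>of_int k - ln u\<bar> ^ r) summable_on UNIV"
      "(\<Sum>\<^sub>\<infinity>k::int. \<bar>chi (exp (- of_int k) * u)\<bar> * \<bar>of_int k - ln u\<bar> ^ r) \<le> M"
    and \<phi>: "integrable mellin_measure \<phi>" "cont_abs_moment r \<phi> < \<infinity>"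
    and int: "\<And>a. integrable mellin_measure (\<lambda>s. \<phi> s * (g ((a + ln s) / w) * ((a + ln s) / w) ^ r))"
    and w: "w > 0" and \<epsilon>: "\<epsilon> \<ge> 0" and H: "H \<ge> 0" and r: "r \<ge> 1" and \<gamma>: "\<gamma> \<ge> 1"
    and g_near: "\<And>z. z \<noteq> 0 \<Longrightarrow> \<bar>z\<bar> \<le> \<delta> \<Longrightarrow> \<bar>g z\<bar> \<le> \<epsilon>"
    and g_bdd: "\<And>z. z \<noteq> 0 \<Longrightarrow> \<bar>g z\<bar> \<le> H"
    and S: "((\<lambda>k::int. chi (exp (- of_int k) * u) * (LINT s|mellin_measure. \<phi> s *
        (g ((of_int k - ln u + ln s) / w) * ((of_int k - ln u + ln s) / w) ^ r))) has_sum S) UNIV"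
  shows "\<bar>S\<bar> \<le> (2 / w) ^ r *
      (\<epsilon> * ((LINT s|mellin_measure. \<bar>\<phi> s\<bar>) * M + (LINT s|mellin_measure. \<bar>\<phi> s * ln s ^ r\<bar>) * N) +
       H * (((LINT s|mellin_measure. \<bar>\<phi> s\<bar>) + (LINT s|mellin_measure. \<bar>\<phi> s * ln s ^ r\<bar>)) *
          tail_moment r chi \<gamma> u) +
       H * ((LINT s|mellin_measure. (if \<bar>ln s\<bar> > \<gamma> then \<bar>\<phi> s\<bar> else 0)) * M +
         (LINT s|mellin_measure. (if \<bar>ln s\<bar> > \<gamma> then \<bar>\<phi> s * ln s ^ r\<bar> else 0)) * N))"
proof -
  define A0 where "A0 = (LINT s|mellin_measure. \<bar>\<phi> s\<bar>)"
  define Ar where "Ar = (LINT s|mellin_measure. \<bar>\<phi> s * ln s ^ r\<bar>)"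
  define T0 where "T0 = (LINT s|mellin_measure. (if \<bar>ln s\<bar> > \<gamma> then \<bar>\<phi> s\<bar> else 0))"
  define Tr where "Tr = (LINT s|mellin_measure. (if \<bar>ln s\<bar> > \<gamma> then \<bar>\<phi> s * ln s ^ r\<bar> else 0))"
  have nonneg: "A0 \<ge> 0" "Ar \<ge> 0" "T0 \<ge> 0" "Tr \<ge> 0"
    unfolding A0_def Ar_def T0_def Tr_def by (intro integral_nonneg_AE AE_I2; simp)+
  define p where "p k = \<bar>chi (exp (- of_int k) * u)\<bar>" for k :: int
  define q where "q k = p k * \<bar>of_int k - ln u\<bar> ^ r" for k :: int
  define t where "t k = (if \<bar>of_int k - ln u\<bar> > \<gamma> then q k else 0)" for k :: int
  let ?Sp = "\<Sum>\<^sub>\<infinity>k. p k" and ?Sq = "\<Sum>\<^sub>\<infinity>k. q k"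
  have p: "(p has_sum ?Sp) UNIV" "?Sp \<le> N" and q: "(q has_sum ?Sq) UNIV" "?Sq \<le> M"
    using N M by (simp_all add: p_def[abs_def] q_def[abs_def])
  have t: "(t has_sum tail_moment r chi \<gamma> u) UNIV"
    using tail_moment_has_sum[OF chi u, of \<gamma>] unfolding t_def q_def p_def .
  let ?B = "\<lambda>k. (2 / w) ^ r * (\<epsilon> * (A0 * q k + Ar * p k) + H * ((A0 + Ar) * t k) + H * (T0 * q k + Tr * p k))"
  have "\<bar>S\<bar> \<le> (2 / w) ^ r *
      (\<epsilon> * (A0 * ?Sq + Ar * ?Sp) + H * ((A0 + Ar) * tail_moment r chi \<gamma> u) + H * (T0 * ?Sq + Tr * ?Sp))"
    unfolding real_norm_def[symmetric]
  proof (rule norm_infsum_le[OF S])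
    show "(?B has_sum (2 / w) ^ r *
      (\<epsilon> * (A0 * ?Sq + Ar * ?Sp) + H * ((A0 + Ar) * tail_moment r chi \<gamma> u) + H * (T0 * ?Sq + Tr * ?Sp))) UNIV"
      by (intro has_sum_cmult_right has_sum_add p q t)
    fix k :: int
    let ?a = "of_int k - ln u"
    let ?c = "if \<bar>?a\<bar> > \<gamma> then H else 0"
    have "p k \<ge> 0" by (simp add: p_def)
    have tail: "p k * (?c * (A0 * \<bar>?a\<bar> ^ r + Ar)) \<le> H * ((A0 + Ar) * t k)"
    proof (cases "\<bar>?a\<bar> > \<gamma>")
      case True
      then have "1 \<le> \<bar>?a\<bar> ^ r" using \<gamma> by simp
      then have "Ar * 1 \<le> Ar * \<bar>?a\<bar> ^ r" using nonneg by (intro mult_left_mono)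
      then have "p k * (H * (A0 * \<bar>?a\<bar> ^ r + Ar)) \<le> p k * (H * (A0 * \<bar>?a\<bar> ^ r + Ar * \<bar>?a\<bar> ^ r))"
        using \<open>p k \<ge> 0\<close> H by (intro mult_left_mono add_left_mono) auto
      then show ?thesis using True by (simp add: t_def q_def algebra_simps)
    qed (simp add: t_def)
    have "p k * \<bar>LINT s|mellin_measure. \<phi> s * (g ((?a + ln s) / w) * ((?a + ln s) / w) ^ r)\<bar> \<le>
        p k * ((2 / w) ^ r * ((\<epsilon> + ?c) * (A0 * \<bar>?a\<bar> ^ r + Ar) + H * (T0 * \<bar>?a\<bar> ^ r + Tr)))"
      unfolding A0_def Ar_def T0_def Tr_def \<gamma>_def
      by (intro mult_left_mono remainder_coefficient_bound[OF \<phi> int w \<epsilon> H r g_near g_bdd] \<open>p k \<ge> 0\<close>) auto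
    also have "\<dots> = (2 / w) ^ r * (\<epsilon> * (A0 * q k + Ar * p k) +
        p k * (?c * (A0 * \<bar>?a\<bar> ^ r + Ar)) + H * (T0 * q k + Tr * p k))"
      by (simp add: q_def algebra_simps)
    also have "\<dots> \<le> ?B k"
      using tail w by (intro mult_left_mono add_right_mono add_left_mono) auto
    finally show "norm (chi (exp (- of_int k) * u) * (LINT s|mellin_measure. \<phi> s *
        (g ((?a + ln s) / w) * ((?a + ln s) / w) ^ r))) \<le> ?B k"
      by (simp add: p_def abs_mult)
  qed
  also have "\<dots> \<le> (2 / w) ^ r *
      (\<epsilon> * (A0 * M + Ar * N) + H * ((A0 + Ar) * tail_moment r chi \<gamma> u) + H * (T0 * M + Tr * N))"
    using p(2) q(2) nonneg \<epsilon> H w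
    by (intro mult_left_mono add_mono order.refl add_nonneg_nonneg mult_nonneg_nonneg) auto
  finally show ?thesis
    unfolding A0_def Ar_def T0_def Tr_def .
qed

section \<open>The asymptotic formula\<close>

theorem theorem4p2:
  fixes chi \<phi> f h :: "real \<Rightarrow> real" and r :: nat and x :: real
  assumes chi_cont: "continuous_on {0<..} chi"
    and phi_L1: "integrable mellin_measure \<phi>"
    and K1_chi: "\<And>u. u > 0 \<Longrightarrow> ((\<lambda>k::int. chi (exp (- of_int k) * u)) has_sum 1) UNIV"
    and K1_phi: "(LINT u|mellin_measure. \<phi> u) = 1"
    and K2_fin: "abs_moment r chi + cont_abs_moment r \<phi> < \<infinity>"
    and K2_tail: "uniform_limit {0<..} (tail_moment r chi) (\<lambda>u. 0) at_top"
    and r: "r \<ge> 1"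
    and x: "x > 0"
    and f: "C_locally_at r f x"
    and h: "mellin_taylor_remainder r f x h"
  shows "(\<forall>w>0. durrmeyer_series chi \<phi> w f x - f x =
            (\<Sum>j=1..r. (mellin_deriv ^^ j) f x / (fact j * w ^ j) *
               (\<Sum>\<eta>=0..j. of_nat (j choose \<eta>) * cont_moment (j - \<eta>) \<phi> * moment \<eta> chi (x powr w))) +
            durrmeyer_remainder chi \<phi> h r x w) \<and>
         durrmeyer_remainder chi \<phi> h r x \<in> o[at_top](\<lambda>w. 1 / w ^ r)"
proof (intro conjI allI impI)
  have chi_fin: "abs_moment r chi < \<infinity>" and phi_fin: "cont_abs_moment r \<phi> < \<infinity>"
    using K2_fin by (auto simp: less_top[symmetric])
  have expansion: "((\<lambda>k::int. chi (exp (- of_int k) * x powr w) *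
      (LINT s|mellin_measure. \<phi> s *
        (h (exp ((of_int k - w * ln x + ln s) / w)) * ((of_int k - w * ln x + ln s) / w) ^ r)))
    has_sum (durrmeyer_series chi \<phi> w f x - f x -
      (\<Sum>j=1..r. (mellin_deriv ^^ j) f x / (fact j * w ^ j) *
        (\<Sum>\<eta>=0..j. of_nat (j choose \<eta>) * cont_moment (j - \<eta>) \<phi> * moment \<eta> chi (x powr w))))) UNIV"
    if "w > 0" for w
    using durrmeyer_expansion[OF chi_cont chi_fin _ phi_L1 K1_phi phi_fin x that f h, OF K1_chi] .
  show "durrmeyer_series chi \<phi> w f x - f x =
      (\<Sum>j=1..r. (mellin_deriv ^^ j) f x / (fact j * w ^ j) *
        (\<Sum>\<eta>=0..j. of_nat (j choose \<eta>) * cont_moment (j - \<eta>) \<phi> * moment \<eta> chi (x powr w))) +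
      durrmeyer_remainder chi \<phi> h r x w" if "w > 0" for w
    unfolding durrmeyer_remainder_eq[OF x that] infsumI[OF expansion[OF that]] by simp

  obtain H where H: "H \<ge> 0" "\<And>z. z \<noteq> 0 \<Longrightarrow> \<bar>h (exp z)\<bar> \<le> H"
    using mellin_taylor_remainder_bounded[OF f h r x] by blast
  obtain M where M: "\<And>u. u > 0 \<Longrightarrow>
      (\<lambda>k::int. \<bar>chi (exp (- of_int k) * u)\<bar> * \<bar>of_int k - ln u\<bar> ^ r) summable_on UNIV"
    "\<And>u. u > 0 \<Longrightarrow>
      (\<Sum>\<^sub>\<infinity>k::int. \<bar>chi (exp (- of_int k) * u)\<bar> * \<bar>of_int k - ln u\<bar> ^ r) \<le> M"
    using abs_moment_bounded[OF chi_fin] by blast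
  obtain N where N: "\<And>u. u > 0 \<Longrightarrow> (\<lambda>k::int. \<bar>chi (exp (- of_int k) * u)\<bar>) summable_on UNIV"
    "\<And>u. u > 0 \<Longrightarrow> (\<Sum>\<^sub>\<infinity>k::int. \<bar>chi (exp (- of_int k) * u)\<bar>) \<le> N"
    using abs_kernel_sum_bounded[OF chi_cont chi_fin] by blast
  have "M \<ge> 0" "N \<ge> 0"
    by (rule order.trans[OF infsum_nonneg M(2)[of 1]], simp_all)
       (rule order.trans[OF infsum_nonneg N(2)[of 1]], simp_all)
  define A0 where "A0 = (LINT s|mellin_measure. \<bar>\<phi> s\<bar>)"
  define Ar where "Ar = (LINT s|mellin_measure. \<bar>\<phi> s * ln s ^ r\<bar>)"
  define T0 where "T0 \<gamma> = (LINT s|mellin_measure. (if \<bar>ln s\<bar> > \<gamma> then \<bar>\<phi> s\<bar> else 0))" for \<gamma>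
  define Tr where "Tr \<gamma> = (LINT s|mellin_measure. (if \<bar>ln s\<bar> > \<gamma> then \<bar>\<phi> s * ln s ^ r\<bar> else 0))" for \<gamma>
  have A: "A0 \<ge> 0" "Ar \<ge> 0"
    unfolding A0_def Ar_def by (intro integral_nonneg_AE AE_I2; simp)+
  have T: "(T0 \<longlongrightarrow> 0) at_top" "(Tr \<longlongrightarrow> 0) at_top"
    unfolding T0_def Tr_def using integrable_mellin_ln_power[OF phi_L1 phi_fin, of r] phi_L1
    by (auto intro!: tendsto_log_tail)

  show "durrmeyer_remainder chi \<phi> h r x \<in> o[at_top](\<lambda>w. 1 / w ^ r)"
  proof (rule landau_o.smallI)
    fix c :: real assume "c > 0"
    \<comment> \<open>w ^ r times the remainder is bounded by 2 ^ r times three terms; each is made at most c' / 3,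
        and the 1 added to C and D only keeps the denominators positive\<close>
    define c' where "c' = c / 2 ^ r"
    define C where "C = A0 * M + Ar * N"
    define D where "D = H * (A0 + Ar)"
    have "c' > 0" "C \<ge> 0" "D \<ge> 0"
      using \<open>c > 0\<close> A H(1) \<open>M \<ge> 0\<close> \<open>N \<ge> 0\<close> by (simp_all add: c'_def C_def D_def)
    define \<epsilon> where "\<epsilon> = c' / 3 / (C + 1)"
    have \<epsilon>: "\<epsilon> > 0" "\<epsilon> * C \<le> c' / 3"
      using \<open>c' > 0\<close> \<open>C \<ge> 0\<close> by (auto simp: \<epsilon>_def divide_simps mult_left_mono)
    obtain d where d: "d > 0" "\<And>z. z \<noteq> 0 \<Longrightarrow> \<bar>z\<bar> < d \<Longrightarrow> \<bar>h (exp z)\<bar> < \<epsilon>"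
      using LIM_D[OF mellin_taylor_remainder_tendsto_0[OF f h r x] \<epsilon>(1)] by auto
    \<comment> \<open>half of d, so that the bound also holds at the endpoint\<close>
    define \<delta> where "\<delta> = d / 2"
    have \<delta>: "\<delta> > 0" "\<And>z. z \<noteq> 0 \<Longrightarrow> \<bar>z\<bar> \<le> \<delta> \<Longrightarrow> \<bar>h (exp z)\<bar> \<le> \<epsilon>"
      using d by (force simp: \<delta>_def)+

    have "\<forall>\<^sub>F \<gamma> in at_top. \<forall>u\<in>{0<..}. dist (tail_moment r chi \<gamma> u) 0 < c' / 3 / (D + 1)"
      using \<open>c' > 0\<close> \<open>D \<ge> 0\<close> by (intro uniform_limitD[OF K2_tail]) simp
    moreover have "((\<lambda>\<gamma>. H * (T0 \<gamma> * M + Tr \<gamma> * N)) \<longlongrightarrow> H * (0 * M + 0 * N)) at_top"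
      by (intro tendsto_intros T)
    then have "\<forall>\<^sub>F \<gamma> in at_top. H * (T0 \<gamma> * M + Tr \<gamma> * N) < c' / 3"
      using \<open>c' > 0\<close> by (intro order_tendstoD(2)[where y="H * (0 * M + 0 * N)"]) auto
    ultimately have "\<forall>\<^sub>F \<gamma> in at_top. \<gamma> \<ge> 1 \<and> H * (T0 \<gamma> * M + Tr \<gamma> * N) < c' / 3 \<and>
        (\<forall>u>0. D * tail_moment r chi \<gamma> u \<le> c' / 3)"
      using eventually_ge_at_top[of 1]
    proof eventually_elim
      case (elim \<gamma>)
      have "D * tail_moment r chi \<gamma> u \<le> c' / 3" if "u > 0" for u
      proof -
        have "tail_moment r chi \<gamma> u \<le> c' / 3 / (D + 1)"
          using elim(1) that by (force simp: dist_real_def)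
        then have "D * tail_moment r chi \<gamma> u \<le> D * (c' / 3 / (D + 1))"
          using \<open>D \<ge> 0\<close> by (rule mult_left_mono)
        also have "\<dots> \<le> c' / 3"
          using \<open>c' > 0\<close> \<open>D \<ge> 0\<close> by (auto simp: divide_simps mult_left_mono)
        finally show ?thesis .
      qed
      then show ?case using elim by simp
    qed
    moreover have "filterlim (\<lambda>w::real. w * (\<delta> / 2)) at_top at_top"
      using \<delta>(1) by (intro filterlim_at_top_mult_tendsto_pos[OF tendsto_const _ filterlim_ident]) simp
    ultimately have "\<forall>\<^sub>F w in at_top. let \<gamma> = w * (\<delta> / 2) in
        \<gamma> \<ge> 1 \<and> H * (T0 \<gamma> * M + Tr \<gamma> * N) < c' / 3 \<and> (\<forall>u>0. D * tail_moment r chi \<gamma> u \<le> c' / 3)"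
      unfolding Let_def by (rule eventually_compose_filterlim)
    then show "\<forall>\<^sub>F w in at_top. norm (durrmeyer_remainder chi \<phi> h r x w) \<le> c * norm (1 / w ^ r)"
      using eventually_gt_at_top[of 0]
    proof eventually_elim
      case (elim w)
      define \<gamma> where "\<gamma> = w * (\<delta> / 2)"
      let ?u = "x powr w"
      have w: "w > 0" and u: "?u > 0" "ln ?u = w * ln x"
        using elim x by (auto simp: ln_powr)
      have \<gamma>: "\<gamma> \<ge> 1" "H * (T0 \<gamma> * M + Tr \<gamma> * N) < c' / 3" "D * tail_moment r chi \<gamma> ?u \<le> c' / 3"
        using elim u(1) by (auto simp: \<gamma>_def Let_def)
      have int: "integrable mellin_measure
          (\<lambda>s. \<phi> s * (h (exp ((a + ln s) / w)) * ((a + ln s) / w) ^ r))" for a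
        using integrable_mellin_remainder[OF phi_L1 K1_phi phi_fin x w f h, of "a + w * ln x"] by simp
      have sum: "((\<lambda>k::int. chi (exp (- of_int k) * ?u) * (LINT s|mellin_measure. \<phi> s *
          (h (exp ((of_int k - ln ?u + ln s) / w)) * ((of_int k - ln ?u + ln s) / w) ^ r)))
          has_sum durrmeyer_remainder chi \<phi> h r x w) UNIV"
        unfolding u(2) durrmeyer_remainder_eq[OF x w] infsumI[OF expansion[OF w]]
        by (rule expansion[OF w])
      have "\<bar>durrmeyer_remainder chi \<phi> h r x w\<bar> \<le> (2 / w) ^ r *
          (\<epsilon> * C + D * tail_moment r chi \<gamma> ?u + H * (T0 \<gamma> * M + Tr \<gamma> * N))"
        using remainder_series_bound[where g="\<lambda>z. h (exp z)" and \<delta>=\<delta> and \<epsilon>=\<epsilon>,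
            OF chi_fin u(1) N(1)[OF u(1)] N(2)[OF u(1)] M(1)[OF u(1)] M(2)[OF u(1)]
              phi_L1 phi_fin int w _ H(1) r _ \<delta>(2) H(2) sum] \<epsilon>(1) \<gamma>(1)
        by (simp add: A0_def Ar_def T0_def Tr_def C_def D_def \<gamma>_def mult.assoc)
      also have "\<dots> \<le> (2 / w) ^ r * c'"
        using \<gamma> \<epsilon>(2) w by (intro mult_left_mono) auto
      also have "\<dots> = c * norm (1 / w ^ r)"
        using w by (simp add: c'_def power_divide)
      finally show ?case by simp
    qed
  qed
qed

end
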